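(* Let $\mathbf{M}$ be a Markov process with state space $(S,\mathcal{S})$ and transition function $p^{t}(x,dy)$, $t\in\mathbb{T}$, $x\in S$. Assume that there is $\pi\in\mathcal{P}(S)$ satisfying $$\lim_{t\to\infty}d_W\big(p^{t}(x,dy),\pi(dy)\big)=0\qquad\text{for every } x\in S,$$ and that $$d_W\big(p^{t}(x_1,dy),p^{t}(x_2,dy)\big)\le d(x_1,x_2)\qquad\text{for all } t\in\mathbb{T},\ x_1,x_2\in S.$$ Then $\pi$ is the unique invariant probability measure for $\mathbf{M}$, and for every $p\ge1$, every $f\in Lip(S)$ and every $\mu\in\mathcal{P}(S)$, $$\frac{1}{t}\int_{[0,t)}f(M_s)\,\tau(ds)\longrightarrow \int_S f(y)\,\pi(dy)\qquad\text{in } L^p(\Omega,\mathbb{P}^{\mu})\ \text{ as } t\nearrow\infty,\ t\in\mathbb{T}.$$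
   Context: State space: $(S,d)$ is a non-empty Polish space, i.e. $d$ is a complete and separable metric on $S$, $\mathcal{S}$ is its Borel $\sigma$-algebra, and $d$ is bounded by $1$: $\sup_{x,y\in S}d(x,y)\le 1$. The time set $\mathbb{T}$ is either $\{0,1,2,\ldots\}$ or $[0,\infty)$, and $\tau$ is the counting measure on $\mathbb{T}$ in the first case and Lebesgue measure in the second. Process: $\mathbf{M}=(\Omega,\mathcal{F},\{\mathbb{P}^{x}\}_{x\in S},\{\mathcal{F}_t\}_{t\in\mathbb{T}},\{\theta_t\}_{t\in\mathbb{T}},\{M_t\}_{t\in\mathbb{T}})$ is a temporally homogeneous normal Markov process with state space $(S,\mathcal{S})$: each $(\Omega,\mathcal{F},\mathbb{P}^x)$ is a probability space; $\{\mathcal{F}_t\}$ is a filtration; $M_t:\Omega\to S$ is $\mathcal{F}_t/\mathcal{S}$-measurable; $\mathbb{P}^x(M_0=x)=1$ (normality); $x\mapsto\mathbb{P}^x(B)$ is $\mathcal{S}$-measurable for $B\in\mathcal{F}$; the shift operators $\theta_t:\Omega\to\Omega$ satisfy $M_t\circ\theta_s=M_{t+s}$; and the Markov property $\mathbb{P}^x(M_{t+s}\in B\mid\mathcal{F}_t)=p^s(M_t,B)$ $\mathbb{P}^x$-a.s. holds for all $s,t\in\mathbb{T}$, $x\in S$, $B\in\mathcal{S}$, where $p^{t}(x,dy):=\mathbb{P}^{x}(M_t\in dy)$ is the transition function. If $\mathbb{T}=[0,\infty)$, $\mathbf{M}$ is assumed progressively measurable: for each $t\ge0$ the map $(s,\omega)\mapsto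 M_s(\omega)$ from $[0,t]\times\Omega$ to $S$ is $\mathcal{B}([0,t])\times\mathcal{F}_t/\mathcal{S}$-measurable. $\mathcal{P}(S)$ is the set of probability measures on $\mathcal{S}$; for $\mu\in\mathcal{P}(S)$, $\mathbb{P}^\mu(d\omega):=\int_S\mathbb{P}^y(d\omega)\,\mu(dy)$. A measure $\pi$ on $\mathcal{S}$ is invariant for $\mathbf{M}$ if $\int_S p^t(x,dy)\,\pi(dx)=\pi(dy)$ for all $t\in\mathbb{T}$. $Lip(S)$ is the space of all $f:S\to\mathbb{R}$ for which there is $L_f\ge0$ with $|f(x)-f(y)|\le L_f\,d(x,y)$ for all $x,y\in S$; the best constant is denoted $|f|_{Lip}$. Since $d\le1$, every $f\in Lip(S)$ is bounded. The $L^1$-Wasserstein metric on $\mathcal{P}(S)$ is $$d_W(\mu,\nu):=\sup_{f\in Lip(S),\,|f|_{Lip}\le1}\left|\int_S f\,d\mu-\int_S f\,d\nu\right|.$$ *)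

theory Defs
  imports "HOL-Probability.Probability"
begin

text \<open>
  The state space is a type of class \<open>polish_space\<close> with metric \<^const>\<open>dist\<close>
  and \<open>\<sigma>\<close>-algebra \<^const>\<open>borel\<close>.  The set \<open>T\<close> of times is a subset of the
  reals, either \<^term>\<open>\<nat> :: real set\<close> or \<^term>\<open>{0..} :: real set\<close>, and
  everything indexed by time is constrained only at times in \<open>T\<close>.
\<close>

definition time_measure :: "real set \<Rightarrow> real measure" where
  "time_measure T = (if T = {0..} then restrict_space lborel {0..} else count_space T)"

definition at_top_in :: "real set \<Rightarrow> real filter" where
  "at_top_in T = inf at_top (principal T)"


definition transition :: "('s::polish_space \<Rightarrow> 'w measure) \<Rightarrow> (real \<Rightarrow> 'w \<Rightarrow> 's) \<Rightarrow> real \<Rightarrow> 's \<Rightarrow> 's measure" where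
  "transition P M t x = distr (P x) borel (M t)"

text \<open>
  \<open>\<F>\<close> and \<open>\<F>\<^sub>t\<close> only serve as measurable spaces; the underlying set \<open>\<Omega>\<close> is
  \<open>space \<F>\<close>.  Membership in \<^const>\<open>prob_algebra\<close> says that each \<open>P x\<close> is a
  probability measure on \<open>\<F>\<close>, and measurability of \<open>P\<close> amounts to measurability of
  \<open>x \<mapsto> P x B\<close> for all \<open>B \<in> sets \<F>\<close>.
\<close>

locale normal_markov_process =
  fixes T :: "real set"
    and \<F> :: "'w measure"
    and P :: "'s::polish_space \<Rightarrow> 'w measure"
    and \<F>\<^sub>t :: "real \<Rightarrow> 'w measure"
    and \<theta> :: "real \<Rightarrow> 'w \<Rightarrow> 'w"
    and M :: "real \<Rightarrow> 'w \<Rightarrow> 's"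
  assumes time_set: "T = \<nat> \<or> T = {0..}"
    and kernel: "P \<in> borel \<rightarrow>\<^sub>M prob_algebra \<F>"
    and filtration_sub: "\<And>t. t \<in> T \<Longrightarrow> subalgebra \<F> (\<F>\<^sub>t t)"
    and filtration_mono: "\<And>s t. s \<in> T \<Longrightarrow> t \<in> T \<Longrightarrow> s \<le> t \<Longrightarrow> subalgebra (\<F>\<^sub>t t) (\<F>\<^sub>t s)"
    and adapted: "\<And>t. t \<in> T \<Longrightarrow> M t \<in> \<F>\<^sub>t t \<rightarrow>\<^sub>M borel"
    and normal: "\<And>x. measure (P x) {\<omega> \<in> space \<F>. M 0 \<omega> = x} = 1"
    and shift_space: "\<And>t. t \<in> T \<Longrightarrow> \<theta> t \<in> space \<F> \<rightarrow> space \<F>"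
    and shift: "\<And>s t \<omega>. s \<in> T \<Longrightarrow> t \<in> T \<Longrightarrow> \<omega> \<in> space \<F> \<Longrightarrow> M t (\<theta> s \<omega>) = M (t + s) \<omega>"
    and markov: "\<And>s t x B. s \<in> T \<Longrightarrow> t \<in> T \<Longrightarrow> B \<in> sets borel \<Longrightarrow>
      AE \<omega> in P x. real_cond_exp (P x) (\<F>\<^sub>t t) (indicator {\<omega> \<in> space \<F>. M (t + s) \<omega> \<in> B}) \<omega>
        = measure (transition P M s (M t \<omega>)) B"
    and progressive: "\<And>t. T = {0..} \<Longrightarrow> t \<ge> 0 \<Longrightarrow>
      (\<lambda>(s, \<omega>). M s \<omega>) \<in> restrict_space borel {0..t} \<Otimes>\<^sub>M \<F>\<^sub>t t \<rightarrow>\<^sub>M borel"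

definition invariant_measure ::
    "real set \<Rightarrow> (real \<Rightarrow> 's::polish_space \<Rightarrow> 's measure) \<Rightarrow> 's measure \<Rightarrow> bool" where
  "invariant_measure T p \<pi> \<longleftrightarrow> sets \<pi> = sets borel \<and>
     (\<forall>t\<in>T. \<forall>B\<in>sets borel. (\<integral>\<^sup>+x. emeasure (p t x) B \<partial>\<pi>) = emeasure \<pi> B)"


definition Lip :: "('s::metric_space \<Rightarrow> real) set" where
  "Lip = {f. \<exists>L. L-lipschitz_on UNIV f}"

definition lip_const :: "('s::metric_space \<Rightarrow> real) \<Rightarrow> real" where
  "lip_const f = Inf {L. L-lipschitz_on UNIV f}"

text \<open>
  The supremum is a conditional one on the reals; for probability measures on a space with
  metric bounded by \<open>1\<close> the set is bounded by \<open>1\<close> and the integrals exist.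
\<close>

definition dW :: "'s::polish_space measure \<Rightarrow> 's measure \<Rightarrow> real" where
  "dW \<mu> \<nu> = (SUP f \<in> {f \<in> Lip. lip_const f \<le> 1}. \<bar>(\<integral>x. f x \<partial>\<mu>) - (\<integral>x. f x \<partial>\<nu>)\<bar>)"


definition in_Lp :: "'w measure \<Rightarrow> real \<Rightarrow> ('w \<Rightarrow> real) \<Rightarrow> bool" where
  "in_Lp N p X \<longleftrightarrow> X \<in> borel_measurable N \<and> integrable N (\<lambda>\<omega>. \<bar>X \<omega>\<bar> powr p)"

definition Lp_norm :: "'w measure \<Rightarrow> real \<Rightarrow> ('w \<Rightarrow> real) \<Rightarrow> real" where
  "Lp_norm N p X = (\<integral>\<omega>. \<bar>X \<omega>\<bar> powr p \<partial>N) powr (1 / p)"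

definition tendsto_Lp ::
    "'w measure \<Rightarrow> real \<Rightarrow> real set \<Rightarrow> (real \<Rightarrow> 'w \<Rightarrow> real) \<Rightarrow> ('w \<Rightarrow> real) \<Rightarrow> bool" where
  "tendsto_Lp N p T X Y \<longleftrightarrow> (\<forall>t\<in>T. in_Lp N p (X t)) \<and> in_Lp N p Y \<and>
     ((\<lambda>t. Lp_norm N p (\<lambda>\<omega>. X t \<omega> - Y \<omega>)) \<longlongrightarrow> 0) (at_top_in T)"

text \<open>At \<open>t = 0\<close> the following is \<open>0\<close> by the convention for division by zero.\<close>

definition time_average ::
    "real set \<Rightarrow> (real \<Rightarrow> 'w \<Rightarrow> 's) \<Rightarrow> ('s \<Rightarrow> real) \<Rightarrow> real \<Rightarrow> 'w \<Rightarrow> real" where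
  "time_average T M f t \<omega> = 1 / t * (LINT s:{0..<t}|time_measure T. f (M s \<omega>))"

end

theory Submission
  imports Defs
begin

text \<open>
  Write \<open>Q\<^sub>t f(x) = \<integral>f dp\<^sup>t(x,\<cdot>)\<close> and \<open>D\<^sub>t(x) = d\<^sub>W(p\<^sup>t(x,\<cdot>), \<pi>)\<close>.  The contraction hypothesis
  says that \<open>Q\<^sub>t\<close> preserves Lipschitz constants, so letting \<open>n \<rightarrow> \<infinity>\<close> in
  \<open>Q\<^bsub>n+t\<^esub> f = Q\<^sub>n (Q\<^sub>t f)\<close> gives \<open>\<integral>f d\<pi> = \<integral>Q\<^sub>t f d\<pi>\<close>, i.e. invariance; uniqueness follows by
  dominated convergence.

  For a Lipschitz \<open>g\<close> with \<open>\<integral>g d\<pi> = 0\<close> and times \<open>s \<le> u\<close>, the Markov property bounds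
  \<open>E\<^sup>x[g(M\<^sub>s) g(M\<^sub>u)]\<close> by \<open>L Q\<^sub>s h(x)\<close> with \<open>h = |Q\<^bsub>u-s\<^esub> g| \<le> L D\<^bsub>u-s\<^esub>\<close>.  As \<open>h\<close> is again
  \<open>L\<close>-Lipschitz, \<open>Q\<^sub>s h(x) \<le> \<integral>h d\<pi> + L D\<^sub>s(x)\<close>, whence
  \<open>|E\<^sup>\<mu>[g(M\<^sub>s) g(M\<^sub>u)]| \<le> L\<^sup>2 (\<integral>D\<^bsub>u-s\<^esub> d\<pi> + \<integral>D\<^sub>s d\<mu>)\<close>.  Both integrals tend to \<open>0\<close> as their time
  index grows, so the averages of this bound over \<open>[0,t)\<^sup>2\<close> vanish: the time averages converge in
  \<open>L\<^sup>2\<close>, and being bounded, in every \<open>L\<^sup>p\<close>.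
\<close>

section \<open>The Wasserstein metric on a space of diameter at most one\<close>

lemma prob_algebra_borelD:
  assumes "\<mu> \<in> space (prob_algebra borel)"
  shows "prob_space \<mu>" "sets \<mu> = sets borel" "space \<mu> = UNIV"
  using assms sets_eq_imp_space_eq[of \<mu> borel] by (auto simp: space_prob_algebra)

lemma lipschitz_borel_measurable:
  fixes f :: "'s::metric_space \<Rightarrow> real"
  assumes "L-lipschitz_on UNIV f"
  shows "f \<in> borel_measurable borel"
  using lipschitz_on_continuous_on[OF assms] by (rule borel_measurable_continuous_onI)

text \<open>Every admissible constant dominates every difference quotient, so the infimum does too
  and is itself admissible. This lets \<open>dW\<close> be handled with
  \<open>1-lipschitz_on\<close> and without \<open>lip_const\<close>.\<close>

lemma lipschitz_unit_iff_lip_const: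
  fixes f :: "'s::metric_space \<Rightarrow> real"
  shows "f \<in> Lip \<and> lip_const f \<le> 1 \<longleftrightarrow> 1-lipschitz_on UNIV f"
proof
  assume f: "f \<in> Lip \<and> lip_const f \<le> 1"
  show "1-lipschitz_on UNIV f"
  proof (rule lipschitz_onI)
    fix x y :: 's
    show "dist (f x) (f y) \<le> 1 * dist x y"
    proof (cases "x = y")
      case False
      have "dist (f x) (f y) / dist x y \<le> lip_const f"
        unfolding lip_const_def
      proof (rule cInf_greatest)
        show "{L. L-lipschitz_on UNIV f} \<noteq> {}" using f by (auto simp: Lip_def)
        show "dist (f x) (f y) / dist x y \<le> L" if "L \<in> {L. L-lipschitz_on UNIV f}" for L
          using that False lipschitz_onD[of L UNIV f x y] by (simp add: divide_simps)
      qed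
      also have "\<dots> \<le> 1" using f by simp
      finally show ?thesis using False by (simp add: divide_simps split: if_splits)
    qed simp
  qed simp
next
  assume f: "1-lipschitz_on UNIV f"
  have "lip_const f \<le> 1"
    unfolding lip_const_def
    using f by (intro cInf_lower bdd_belowI[of _ 0]) (auto intro: lipschitz_on_nonneg)
  with f show "f \<in> Lip \<and> lip_const f \<le> 1" by (auto simp: Lip_def)
qed

lemma dW_eq_SUP_lipschitz:
  "dW \<mu> \<nu> = (SUP f \<in> {f. 1-lipschitz_on UNIV f}. \<bar>(\<integral>x. f x \<partial>\<mu>) - (\<integral>x. f x \<partial>\<nu>)\<bar>)"
  unfolding dW_def lipschitz_unit_iff_lip_const ..

lemma dW_least:
  assumes "\<And>f :: 's::polish_space \<Rightarrow> real. 1-lipschitz_on UNIV f \<Longrightarrow> \<bar>(\<integral>x. f x \<partial>\<mu>) - (\<integral>x. f x \<partial>\<nu>)\<bar> \<le> c"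
  shows "dW \<mu> \<nu> \<le> c"
proof -
  \<comment> \<open>The zero function makes the index set of the supremum nonempty, as a
    least-upper-bound argument on the reals requires.\<close>
  have "1-lipschitz_on UNIV (\<lambda>_::'s. 0::real)"
    by (rule lipschitz_onI) auto
  then show ?thesis
    unfolding dW_eq_SUP_lipschitz using assms by (intro cSUP_least) auto
qed

text \<open>Closed sets form an intersection-stable generator of the Borel sets, and the indicator
  of a nonempty closed set is a bounded pointwise limit of Lipschitz functions. Both invariance and
  uniqueness are reduced to this.\<close>

lemma Lipschitz_integrals_determine_measure:
  fixes \<mu> \<nu> :: "'s::metric_space measure"
  assumes \<mu>: "\<mu> \<in> space (prob_algebra borel)" and \<nu>: "\<nu> \<in> space (prob_algebra borel)"
    and eq: "\<And>(f :: 's \<Rightarrow> real) L. L-lipschitz_on UNIV f \<Longrightarrow> (\<integral>x. f x \<partial>\<mu>) = (\<integral>x. f x \<partial>\<nu>)"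
  shows "\<mu> = \<nu>"
proof (rule measure_eqI_generator_eq[of "Collect closed" UNIV _ _ "\<lambda>_. UNIV"])
  interpret \<mu>: prob_space \<mu> using prob_algebra_borelD[OF \<mu>] by simp
  interpret \<nu>: prob_space \<nu> using prob_algebra_borelD[OF \<nu>] by simp
  note [measurable_cong] = prob_algebra_borelD(2)[OF \<mu>] prob_algebra_borelD(2)[OF \<nu>]
  show "sets \<mu> = sigma_sets UNIV (Collect closed)" "sets \<nu> = sigma_sets UNIV (Collect closed)"
    by (simp_all add: prob_algebra_borelD(2)[OF \<mu>] prob_algebra_borelD(2)[OF \<nu>] borel_eq_closed)
  show "Int_stable (Collect closed :: 's set set)"
    by (auto simp: Int_stable_def)
  fix C :: "'s set"
  assume "C \<in> Collect closed"
  then have C: "closed C" by simp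
  then have C': "C \<in> sets borel" by (rule borel_closed)
  show "emeasure \<mu> C = emeasure \<nu> C"
  \<comment> \<open>The empty set is split off because \<open>infdist x {}\<close> is 0 by
    convention, which would make the approximants below constantly 1.\<close>
  proof (cases "C = {}")
    case False
    \<comment> \<open>Tent functions: equal to 1 on \<open>C\<close> and 0 at distance at least
      \<open>1 / n\<close> from \<open>C\<close>. Closedness of \<open>C\<close> gives positive
      distance outside \<open>C\<close>, hence convergence to the indicator.\<close>
    define g where "g n x = max 0 (1 - real n * infdist x C)" for n x
    have g_lip: "(real n)-lipschitz_on UNIV (g n)" for n
    proof (rule lipschitz_onI)
      fix x y
      have "\<bar>real n * infdist x C - real n * infdist y C\<bar> \<le> real n * dist x y"
        using mult_left_mono[OF infdist_triangle_abs[of x C y], of "real n"]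
        by (simp add: abs_mult flip: right_diff_distrib)
      then show "dist (g n x) (g n y) \<le> real n * dist x y"
        by (auto simp: g_def dist_real_def max_def)
    qed simp
    have [measurable]: "g n \<in> borel_measurable borel" for n
      using g_lip by (rule lipschitz_borel_measurable)
    have g_lim: "(\<lambda>n. g n x) \<longlonglongrightarrow> indicator C x" for x
    proof (cases "x \<in> C")
      case True
      then show ?thesis by (simp add: g_def infdist_zero)
    next
      case nC: False
      then have pos: "infdist x C > 0"
        using in_closed_iff_infdist_zero[OF C False, of x] infdist_nonneg[of x C] by linarith
      obtain m :: nat where m: "1 / infdist x C < real m"
        using reals_Archimedean2 by blast
      have "g n x = 0" if "n \<ge> m" for n
      proof -
        have "1 < real m * infdist x C" using m pos by (simp add: divide_simps)
        also have "\<dots> \<le> real n * infdist x C" using that pos by (intro mult_right_mono) auto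
        finally show ?thesis by (simp add: g_def)
      qed
      then have "eventually (\<lambda>n. g n x = 0) sequentially"
        by (auto simp: eventually_sequentially)
      then show ?thesis using nC by (simp add: tendsto_eventually)
    qed
    have g_bound: "norm (g n x) \<le> 1" for n x
      using infdist_nonneg[of x C] by (auto simp: g_def)
    have "(\<lambda>n. \<integral>x. g n x \<partial>N) \<longlonglongrightarrow> measure N C" 
      if N: "prob_space N" "sets N = sets borel" for N
    proof -
      interpret prob_space N by fact
      note [measurable_cong] = N(2)
      have "(\<lambda>n. \<integral>x. g n x \<partial>N) \<longlonglongrightarrow> (\<integral>x. indicator C x \<partial>N)"
        using C' by (intro integral_dominated_convergence[where w = "\<lambda>_. 1"])
          (auto simp: g_lim g_bound[unfolded real_norm_def])
      then show ?thesis
        using C' sets_eq_imp_space_eq[OF N(2)] by simp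
    qed
    from this[of \<mu>] this[of \<nu>] have "measure \<mu> C = measure \<nu> C"
      using eq[OF g_lip] prob_algebra_borelD[OF \<mu>] prob_algebra_borelD[OF \<nu>]
      by (simp add: LIMSEQ_unique)
    then show ?thesis by (simp add: \<mu>.emeasure_eq_measure \<nu>.emeasure_eq_measure)
  qed simp
next
  interpret \<mu>: prob_space \<mu> using prob_algebra_borelD[OF \<mu>] by simp
  show "emeasure \<mu> UNIV \<noteq> \<infinity>" by simp
qed auto

context
  assumes dist_le_1: "\<And>x y :: 's::polish_space. dist x y \<le> 1"
begin

lemma lipschitz_diff_le:
  fixes f :: "'s \<Rightarrow> real"
  assumes "L-lipschitz_on UNIV f"
  shows "\<bar>f x - f y\<bar> \<le> L"
  using lipschitz_onD[OF assms, of x y] mult_left_le[OF dist_le_1 lipschitz_on_nonneg[OF assms], of x y]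
  by (simp add: dist_real_def)

lemma lipschitz_bounded:
  fixes f :: "'s \<Rightarrow> real"
  assumes "L-lipschitz_on UNIV f"
  shows "\<exists>B. \<forall>x. \<bar>f x\<bar> \<le> B"
proof (intro exI allI)
  show "\<bar>f x\<bar> \<le> \<bar>f undefined\<bar> + L" for x
    using lipschitz_diff_le[OF assms, of x undefined] by linarith
qed

lemma lipschitz_integrable:
  fixes f :: "'s \<Rightarrow> real"
  assumes f: "L-lipschitz_on UNIV f" and \<mu>: "\<mu> \<in> space (prob_algebra borel)"
  shows "integrable \<mu> f"
proof -
  interpret prob_space \<mu> using prob_algebra_borelD[OF \<mu>] by simp
  obtain B where "\<And>x. \<bar>f x\<bar> \<le> B" using lipschitz_bounded[OF f] by blast
  then show ?thesis
    using lipschitz_borel_measurable[OF f] prob_algebra_borelD[OF \<mu>]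
    by (intro integrable_const_bound[of _ B]) (auto cong: measurable_cong_sets)
qed

lemma lipschitz_integral_deviation:
  fixes f :: "'s \<Rightarrow> real"
  assumes f: "L-lipschitz_on UNIV f" and \<mu>: "\<mu> \<in> space (prob_algebra borel)"
  shows "\<bar>f y - (\<integral>x. f x \<partial>\<mu>)\<bar> \<le> L"
proof -
  interpret prob_space \<mu> using prob_algebra_borelD[OF \<mu>] by simp
  have "f y - L \<le> f x" "f x \<le> f y + L" for x
    using lipschitz_diff_le[OF f, of x y] by linarith+
  then have "f y - L \<le> (\<integral>x. f x \<partial>\<mu>)" "(\<integral>x. f x \<partial>\<mu>) \<le> f y + L"
    using lipschitz_integrable[OF f \<mu>] by (auto intro!: integral_ge_const integral_le_const)
  then show ?thesis by linarith
qed

text \<open>Integrating the pointwise deviation from the \<open>\<mu>\<close>-mean against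
  \<open>\<nu>\<close> gives the bound. It keeps the supremum in \<open>dW\<close> finite and
  settles the case \<open>L = 0\<close> below.\<close>

lemma lipschitz_integral_diff_le:
  fixes f :: "'s \<Rightarrow> real"
  assumes f: "L-lipschitz_on UNIV f"
    and \<mu>: "\<mu> \<in> space (prob_algebra borel)" and \<nu>: "\<nu> \<in> space (prob_algebra borel)"
  shows "\<bar>(\<integral>x. f x \<partial>\<mu>) - (\<integral>x. f x \<partial>\<nu>)\<bar> \<le> L"
proof -
  interpret prob_space \<nu> using prob_algebra_borelD[OF \<nu>] by simp
  have "(\<integral>x. f x \<partial>\<mu>) - L \<le> f y" "f y \<le> (\<integral>x. f x \<partial>\<mu>) + L" for y
    using lipschitz_integral_deviation[OF f \<mu>, of y] by linarith+
  then have "(\<integral>x. f x \<partial>\<mu>) - L \<le> (\<integral>x. f x \<partial>\<nu>)" "(\<integral>x. f x \<partial>\<nu>) \<le> (\<integral>x. f x \<partial>\<mu>) + L"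
    using lipschitz_integrable[OF f \<nu>] by (auto intro!: integral_ge_const integral_le_const)
  then show ?thesis by linarith
qed

text \<open>Rescaling to \<open>f / L\<close> gives an admissible test function for
  \<open>dW\<close>. For \<open>L = 0\<close> rescaling is impossible, but then the two integrals
  coincide.\<close>

lemma dW_upper:
  fixes f :: "'s \<Rightarrow> real"
  assumes f: "L-lipschitz_on UNIV f"
    and \<mu>: "\<mu> \<in> space (prob_algebra borel)" and \<nu>: "\<nu> \<in> space (prob_algebra borel)"
  shows "\<bar>(\<integral>x. f x \<partial>\<mu>) - (\<integral>x. f x \<partial>\<nu>)\<bar> \<le> L * dW \<mu> \<nu>"
proof (cases "L = 0")
  case True
  then show ?thesis using lipschitz_integral_diff_le[OF f \<mu> \<nu>] by simp
next
  case False
  then have L: "L > 0" using lipschitz_on_nonneg[OF f] by simp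
  define g where "g x = f x / L" for x
  have g: "1-lipschitz_on UNIV g"
  proof (rule lipschitz_onI)
    fix x y
    have "dist (g x) (g y) = dist (f x) (f y) / L"
      using L by (simp add: g_def dist_real_def flip: diff_divide_distrib)
    also have "\<dots> \<le> L * dist x y / L"
      using lipschitz_onD[OF f, of x y] L by (intro divide_right_mono) auto
    finally show "dist (g x) (g y) \<le> 1 * dist x y" using L by simp
  qed simp
  have "\<bar>(\<integral>x. g x \<partial>\<mu>) - (\<integral>x. g x \<partial>\<nu>)\<bar> \<le> dW \<mu> \<nu>"
    unfolding dW_eq_SUP_lipschitz
    using g lipschitz_integral_diff_le[OF _ \<mu> \<nu>]
    by (intro cSUP_upper bdd_aboveI2[where M = 1]) auto
  then show ?thesis
    using L unfolding g_def by (simp add: divide_simps mult.commute flip: diff_divide_distrib)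
qed

lemma dW_nonneg:
  fixes \<mu> :: "'s measure"
  assumes "\<mu> \<in> space (prob_algebra borel)" "\<nu> \<in> space (prob_algebra borel)"
  shows "0 \<le> dW \<mu> \<nu>"
  using dW_upper[of 1 "\<lambda>_. 0", OF _ assms] by (simp add: lipschitz_on_def)

lemma dW_le_1:
  fixes \<mu> :: "'s measure"
  assumes "\<mu> \<in> space (prob_algebra borel)" "\<nu> \<in> space (prob_algebra borel)"
  shows "dW \<mu> \<nu> \<le> 1"
  using lipschitz_integral_diff_le[OF _ assms] by (rule dW_least)

end

section \<open>The Markov property for integrals\<close>

context normal_markov_process
begin

lemma zero_in_T: "0 \<in> T"
  and of_nat_in_T: "real n \<in> T"
  and add_in_T: "s \<in> T \<Longrightarrow> t \<in> T \<Longrightarrow> s + t \<in> T"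
  and diff_in_T: "s \<in> T \<Longrightarrow> t \<in> T \<Longrightarrow> s \<le> t \<Longrightarrow> t - s \<in> T"
  and T_nonneg: "t \<in> T \<Longrightarrow> 0 \<le> t"
  using time_set by (auto elim!: Nats_cases simp flip: of_nat_add of_nat_diff)

lemma prob_space_P: "prob_space (P x)"
  and sets_P: "sets (P x) = sets \<F>"
  and space_P: "space (P x) = space \<F>"
  using measurable_space[OF kernel, of x] sets_eq_imp_space_eq[of "P x" \<F>]
  by (auto simp: space_prob_algebra)

lemma M_measurable: "t \<in> T \<Longrightarrow> M t \<in> \<F> \<rightarrow>\<^sub>M borel"
  using measurable_from_subalg[OF filtration_sub adapted] .

lemma M_measurable_P: "t \<in> T \<Longrightarrow> M t \<in> P x \<rightarrow>\<^sub>M borel"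
  using M_measurable measurable_cong_sets[OF sets_P refl] by blast

lemma transition_measurable:
  assumes "t \<in> T"
  shows "transition P M t \<in> borel \<rightarrow>\<^sub>M prob_algebra borel"
  unfolding transition_def[abs_def]
  by (rule measurable_compose[OF kernel measurable_distr_prob_space[OF M_measurable[OF assms]]])

lemma transition_in_prob_algebra:
  "t \<in> T \<Longrightarrow> transition P M t x \<in> space (prob_algebra borel)"
  using measurable_space[OF transition_measurable] by simp

lemma integral_transition:
  fixes h :: "'s \<Rightarrow> real"
  assumes "t \<in> T" "h \<in> borel_measurable borel"
  shows "(\<integral>y. h y \<partial>transition P M t x) = (\<integral>\<omega>. h (M t \<omega>) \<partial>P x)"
  unfolding transition_def by (rule integral_distr[OF M_measurable_P[OF assms(1)] assms(2)])

lemma transition_integral_measurable: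
  fixes h :: "'s \<Rightarrow> real"
  assumes "t \<in> T" "h \<in> borel_measurable borel"
  shows "(\<lambda>x. \<integral>y. h y \<partial>transition P M t x) \<in> borel_measurable borel"
  by (rule measurable_compose[OF measurable_prob_algebraD[OF transition_measurable[OF assms(1)]]
        integral_measurable_subprob_algebra[OF assms(2)]])

lemma transition_integral_bounded:
  fixes h :: "'s \<Rightarrow> real"
  assumes t: "t \<in> T" and bnd: "\<And>y. \<bar>h y\<bar> \<le> B"
  shows "\<bar>\<integral>y. h y \<partial>transition P M t x\<bar> \<le> B"
proof -
  interpret prob_space "transition P M t x"
    using prob_algebra_borelD[OF transition_in_prob_algebra[OF t]] by simp
  have "\<bar>\<integral>y. h y \<partial>transition P M t x\<bar> \<le> (\<integral>y. \<bar>h y\<bar> \<partial>transition P M t x)"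
    by (rule integral_abs_bound)
  also have "\<dots> \<le> (\<integral>y. B \<partial>transition P M t x)"
    using bnd order_trans[OF abs_ge_zero bnd] by (intro integral_mono') auto
  finally show ?thesis by (simp add: prob_space)
qed

text \<open>Since \<open>\<phi> (M t \<omega>)\<close> is measurable for the past at time
  \<open>t\<close>, the indicator may be replaced under the integral by its conditional expectation,
  which the Markov property identifies.\<close>

lemma markov_indicator:
  assumes st: "s \<in> T" "t \<in> T"
    and \<phi> [measurable]: "\<phi> \<in> borel_measurable borel" and bnd: "\<And>y. \<bar>\<phi> y\<bar> \<le> C"
    and B [measurable]: "B \<in> sets borel"
  shows "(\<integral>\<omega>. \<phi> (M t \<omega>) * indicator B (M (t + s) \<omega>) \<partial>P x)
    = (\<integral>\<omega>. \<phi> (M t \<omega>) * measure (transition P M s (M t \<omega>)) B \<partial>P x)"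
proof -
  interpret prob_space "P x" by (rule prob_space_P)
  have sub: "subalgebra (P x) (\<F>\<^sub>t t)"
    using filtration_sub[OF st(2)] by (simp add: subalgebra_def space_P sets_P)
  interpret finite_measure_subalgebra "P x" "\<F>\<^sub>t t"
    by unfold_locales (rule sub)
  note [measurable] = M_measurable_P[OF st(2)] M_measurable_P[OF add_in_T[OF st(2,1)]]
  \<comment> \<open>The event in exactly the form of the Markov axiom. It agrees with the composed
    indicator only on the underlying space, hence \<open>Z_eq\<close>.\<close>
  define Z :: "'w \<Rightarrow> real" where "Z = indicator {\<omega> \<in> space \<F>. M (t + s) \<omega> \<in> B}"
  have Z_eq: "Z \<omega> = indicator B (M (t + s) \<omega>)" if "\<omega> \<in> space (P x)" for \<omega>
    using that by (simp add: Z_def indicator_def space_P)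
  have Z [measurable]: "Z \<in> borel_measurable (P x)"
    by (subst measurable_cong[OF Z_eq]) auto
  have \<phi>M: "(\<lambda>\<omega>. \<phi> (M t \<omega>)) \<in> borel_measurable (\<F>\<^sub>t t)"
    by (rule measurable_compose[OF adapted[OF st(2)] \<phi>])
  have int: "integrable (P x) (\<lambda>\<omega>. \<phi> (M t \<omega>) * Z \<omega>)"
  proof (rule integrable_const_bound[of _ C])
    show "AE \<omega> in P x. norm (\<phi> (M t \<omega>) * Z \<omega>) \<le> C"
      using bnd order_trans[OF abs_ge_zero bnd]
      by (auto simp: Z_def indicator_def abs_mult)
  qed simp
  have "(\<integral>\<omega>. \<phi> (M t \<omega>) * indicator B (M (t + s) \<omega>) \<partial>P x) = (\<integral>\<omega>. \<phi> (M t \<omega>) * Z \<omega> \<partial>P x)"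
    by (intro Bochner_Integration.integral_cong) (auto simp: Z_eq)
  also have "\<dots> = (\<integral>\<omega>. \<phi> (M t \<omega>) * real_cond_exp (P x) (\<F>\<^sub>t t) Z \<omega> \<partial>P x)"
    by (rule real_cond_exp_intg(2)[OF int \<phi>M Z, symmetric])
  also have "\<dots> = (\<integral>\<omega>. \<phi> (M t \<omega>) * measure (transition P M s (M t \<omega>)) B \<partial>P x)"
  proof (rule integral_cong_AE)
    show "(\<lambda>\<omega>. \<phi> (M t \<omega>) * measure (transition P M s (M t \<omega>)) B) \<in> borel_measurable (P x)"
      by (intro borel_measurable_times measurable_compose[OF M_measurable_P[OF st(2)]]
          measurable_compose[OF transition_measurable[OF st(1)] measurable_measure_prob_algebra] \<phi> B)
    show "AE \<omega> in P x. \<phi> (M t \<omega>) * real_cond_exp (P x) (\<F>\<^sub>t t) Z \<omega>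
        = \<phi> (M t \<omega>) * measure (transition P M s (M t \<omega>)) B"
      using markov[OF st B, of x] unfolding Z_def by eventually_elim simp
  qed simp
  finally show ?thesis .
qed

text \<open>A nonnegative weight can serve as a density. The passage from indicators to bounded
  \<open>h\<close> then becomes an equality of two measures, \<open>K\<close> and \<open>K'\<close>,
  checked on Borel sets and afterwards integrated against \<open>h\<close>.\<close>

lemma markov_integral_nonneg:
  fixes \<phi> h :: "'s \<Rightarrow> real"
  assumes st: "s \<in> T" "t \<in> T"
    and \<phi> [measurable]: "\<phi> \<in> borel_measurable borel" and \<phi>_bnd: "\<And>y. 0 \<le> \<phi> y" "\<And>y. \<phi> y \<le> C"
    and h [measurable]: "h \<in> borel_measurable borel" and h_bnd: "\<And>y. \<bar>h y\<bar> \<le> D"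
  shows "(\<integral>\<omega>. \<phi> (M t \<omega>) * h (M (t + s) \<omega>) \<partial>P x)
    = (\<integral>\<omega>. \<phi> (M t \<omega>) * (\<integral>y. h y \<partial>transition P M s (M t \<omega>)) \<partial>P x)"
proof -
  interpret prob_space "P x" by (rule prob_space_P)
  note [measurable] = M_measurable_P[OF st(2)] M_measurable_P[OF add_in_T[OF st(2,1)]]
  note tr = prob_algebra_borelD[OF transition_in_prob_algebra[OF st(1)]]
  note tr_meas [measurable] = measurable_prob_algebraD[OF transition_measurable[OF st(1)]]
  define N where "N = density (P x) (\<lambda>\<omega>. ennreal (\<phi> (M t \<omega>)))"
  have [measurable_cong]: "sets N = sets (P x)" by (simp add: N_def)
  \<comment> \<open>Under the weighted measure, \<open>K\<close> is the law at time
    \<open>t + s\<close>, while \<open>K'\<close> is the law at time \<open>t\<close> pushed through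
    the kernel of lag \<open>s\<close>.\<close>
  define K where "K = distr N borel (M (t + s))"
  define K' where "K' = distr N borel (M t) \<bind> transition P M s"
  have int_bnd: "integrable (P x) (\<lambda>\<omega>. \<phi> (M t \<omega>) * k \<omega>)"
    if "k \<in> borel_measurable (P x)" "\<And>\<omega>. \<bar>k \<omega>\<bar> \<le> 1" for k
  proof (rule integrable_const_bound[of _ "C * 1"])
    show "AE \<omega> in P x. norm (\<phi> (M t \<omega>) * k \<omega>) \<le> C * 1"
    proof (rule AE_I2)
      fix \<omega>
      show "norm (\<phi> (M t \<omega>) * k \<omega>) \<le> C * 1"
        unfolding real_norm_def abs_mult
        using \<phi>_bnd[of "M t \<omega>"] that(2)[of \<omega>] by (intro mult_mono) auto
    qed
  qed (use that in measurable)
  \<comment> \<open>Finiteness of \<open>N\<close> is what later permits integrating a signed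
    \<open>h\<close> against the composed kernel.\<close>
  have "emeasure N (space N) = (\<integral>\<^sup>+\<omega>. ennreal (\<phi> (M t \<omega>)) \<partial>P x)"
    by (simp add: N_def emeasure_density cong: nn_integral_cong)
  also have "\<dots> = ennreal (\<integral>\<omega>. \<phi> (M t \<omega>) \<partial>P x)"
    using int_bnd[of "\<lambda>_. 1"] \<phi>_bnd by (intro nn_integral_eq_integral) auto
  finally have fin: "finite_measure N" by (intro finite_measureI) simp
  then have fin': "finite_measure (distr N borel (M t))"
    by (rule finite_measure.finite_measure_distr) simp
  have "K = K'"
  proof (rule measure_eqI)
    show "sets K = sets K'"
      unfolding K_def K'_def by (subst sets_bind[where N = borel]) (auto simp: tr)
    fix B assume "B \<in> sets K"
    then have B [measurable]: "B \<in> sets borel" by (simp add: K_def)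
    have mB [measurable]: "(\<lambda>\<omega>. measure (transition P M s (M t \<omega>)) B) \<in> borel_measurable (P x)"
      by (rule measurable_compose[OF M_measurable_P[OF st(2)]
            measurable_compose[OF transition_measurable[OF st(1)] measurable_measure_prob_algebra[OF B]]])
    have "emeasure K B = (\<integral>\<^sup>+\<omega>. indicator B (M (t + s) \<omega>) \<partial>N)"
      unfolding K_def by (subst nn_integral_indicator[symmetric], simp, subst nn_integral_distr) auto
    also have "\<dots> = (\<integral>\<^sup>+\<omega>. ennreal (\<phi> (M t \<omega>) * indicator B (M (t + s) \<omega>)) \<partial>P x)"
      unfolding N_def by (subst nn_integral_density)
        (auto intro!: nn_integral_cong simp: indicator_def)
    also have "\<dots> = ennreal (\<integral>\<omega>. \<phi> (M t \<omega>) * indicator B (M (t + s) \<omega>) \<partial>P x)"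
      using \<phi>_bnd by (intro nn_integral_eq_integral int_bnd) auto
    also have "\<dots> = ennreal (\<integral>\<omega>. \<phi> (M t \<omega>) * measure (transition P M s (M t \<omega>)) B \<partial>P x)"
      using \<phi>_bnd by (subst markov_indicator[OF st \<phi> _ B, of C]) auto
    also have "\<dots> = (\<integral>\<^sup>+\<omega>. ennreal (\<phi> (M t \<omega>) * measure (transition P M s (M t \<omega>)) B) \<partial>P x)"
      using \<phi>_bnd prob_space.prob_le_1[OF tr(1)]
      by (intro nn_integral_eq_integral[symmetric] int_bnd) (auto simp: measure_nonneg)
    also have "\<dots> = (\<integral>\<^sup>+\<omega>. ennreal (\<phi> (M t \<omega>)) * emeasure (transition P M s (M t \<omega>)) B \<partial>P x)"
      using \<phi>_bnd finite_measure.emeasure_eq_measure[OF prob_space.finite_measure[OF tr(1)]]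
      by (intro nn_integral_cong) (simp add: ennreal_mult)
    also have "\<dots> = (\<integral>\<^sup>+\<omega>. emeasure (transition P M s (M t \<omega>)) B \<partial>N)"
      unfolding N_def by (subst nn_integral_density) auto
    also have "\<dots> = (\<integral>\<^sup>+y. emeasure (transition P M s y) B \<partial>distr N borel (M t))"
      by (subst nn_integral_distr) auto
    also have "\<dots> = emeasure K' B"
      unfolding K'_def by (rule emeasure_bind[symmetric, where N = borel]) auto
    finally show "emeasure K B = emeasure K' B" .
  qed
  have "(\<integral>\<omega>. \<phi> (M t \<omega>) * h (M (t + s) \<omega>) \<partial>P x) = (\<integral>\<omega>. h (M (t + s) \<omega>) \<partial>N)"
    unfolding N_def using \<phi>_bnd by (subst integral_density) auto
  also have "\<dots> = (\<integral>y. h y \<partial>K)"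
    unfolding K_def by (subst integral_distr) auto
  also have "\<dots> = (\<integral>y. (\<integral>z. h z \<partial>transition P M s y) \<partial>distr N borel (M t))"
    unfolding \<open>K = K'\<close> K'_def
  proof (rule integral_bind[OF h _ _ fin'])
    show "AE y in distr N borel (M t).
        emeasure (transition P M s y) (space (transition P M s y)) \<le> ennreal 1"
      using prob_space.emeasure_space_1[OF tr(1)] by simp
  qed (use h_bnd in auto)
  also have "\<dots> = (\<integral>\<omega>. (\<integral>z. h z \<partial>transition P M s (M t \<omega>)) \<partial>N)"
    by (subst integral_distr) (auto intro: transition_integral_measurable[OF st(1) h])
  also have "\<dots> = (\<integral>\<omega>. \<phi> (M t \<omega>) * (\<integral>y. h y \<partial>transition P M s (M t \<omega>)) \<partial>P x)"
    unfolding N_def using \<phi>_bnd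
    by (subst integral_density)
      (auto intro: measurable_compose[OF M_measurable_P[OF st(2)] transition_integral_measurable[OF st(1) h]])
  finally show ?thesis .
qed

text \<open>Signed \<open>\<phi>\<close> are reduced to nonnegative ones by adding the bound \<open>C\<close>.\<close>

lemma markov_integral:
  fixes \<phi> h :: "'s \<Rightarrow> real"
  assumes st: "s \<in> T" "t \<in> T"
    and \<phi> [measurable]: "\<phi> \<in> borel_measurable borel" and \<phi>_bnd: "\<And>y. \<bar>\<phi> y\<bar> \<le> C"
    and h [measurable]: "h \<in> borel_measurable borel" and h_bnd: "\<And>y. \<bar>h y\<bar> \<le> D"
  shows "(\<integral>\<omega>. \<phi> (M t \<omega>) * h (M (t + s) \<omega>) \<partial>P x)
    = (\<integral>\<omega>. \<phi> (M t \<omega>) * (\<integral>y. h y \<partial>transition P M s (M t \<omega>)) \<partial>P x)"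
proof -
  interpret prob_space "P x" by (rule prob_space_P)
  note [measurable] = M_measurable_P[OF st(2)] M_measurable_P[OF add_in_T[OF st(2,1)]]
    measurable_compose[OF M_measurable_P[OF st(2)] transition_integral_measurable[OF st(1) h]]
  have shifted: "(\<integral>\<omega>. (\<phi> (M t \<omega>) + C) * h (M (t + s) \<omega>) \<partial>P x)
    = (\<integral>\<omega>. (\<phi> (M t \<omega>) + C) * (\<integral>y. h y \<partial>transition P M s (M t \<omega>)) \<partial>P x)"
  proof (rule markov_integral_nonneg[OF st, where C = "2 * C"])
    show "0 \<le> \<phi> y + C" "\<phi> y + C \<le> 2 * C" for y
      using \<phi>_bnd[of y] by linarith+
  qed (use h_bnd in auto)
  \<comment> \<open>The bound \<open>C\<close> is itself a nonnegative weight; subtracting its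
    identity from the shifted one leaves the claim for \<open>\<phi>\<close>.\<close>
  have const: "(\<integral>\<omega>. C * h (M (t + s) \<omega>) \<partial>P x)
    = (\<integral>\<omega>. C * (\<integral>y. h y \<partial>transition P M s (M t \<omega>)) \<partial>P x)"
    using order_trans[OF abs_ge_zero \<phi>_bnd] h_bnd
    by (intro markov_integral_nonneg[OF st, where C = C and D = D]) auto
  have int: "integrable (P x) (\<lambda>\<omega>. a \<omega> * k \<omega>)"
    if "k \<in> borel_measurable (P x)" "\<And>\<omega>. \<bar>k \<omega>\<bar> \<le> D"
      "a \<in> borel_measurable (P x)" "\<And>\<omega>. \<bar>a \<omega>\<bar> \<le> C" for a k
  proof (rule integrable_const_bound[of _ "C * D"])
    show "AE \<omega> in P x. norm (a \<omega> * k \<omega>) \<le> C * D"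
    proof (rule AE_I2)
      fix \<omega>
      show "norm (a \<omega> * k \<omega>) \<le> C * D"
        unfolding real_norm_def abs_mult
        using order_trans[OF abs_ge_zero that(4)] that(2)[of \<omega>] that(4)[of \<omega>]
        by (intro mult_mono) auto
    qed
  qed (use that in measurable)
  have C: "\<bar>C\<bar> \<le> C" using order_trans[OF abs_ge_zero \<phi>_bnd] by simp
  have split: "(\<integral>\<omega>. (\<phi> (M t \<omega>) + C) * k \<omega> \<partial>P x)
      = (\<integral>\<omega>. \<phi> (M t \<omega>) * k \<omega> \<partial>P x) + (\<integral>\<omega>. C * k \<omega> \<partial>P x)"
    if "k \<in> borel_measurable (P x)" "\<And>\<omega>. \<bar>k \<omega>\<bar> \<le> D" for k
    unfolding distrib_right
    using that C \<phi>_bnd by (intro Bochner_Integration.integral_add int) auto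
  show ?thesis
    using shifted const split[of "\<lambda>\<omega>. h (M (t + s) \<omega>)"]
      split[of "\<lambda>\<omega>. \<integral>y. h y \<partial>transition P M s (M t \<omega>)"]
      h_bnd transition_integral_bounded[OF st(1) h_bnd] by force
qed

text \<open>This is the integrated Markov property with constant weight 1.\<close>

lemma chapman_kolmogorov:
  fixes h :: "'s \<Rightarrow> real"
  assumes st: "s \<in> T" "t \<in> T"
    and h: "h \<in> borel_measurable borel" and h_bnd: "\<And>y. \<bar>h y\<bar> \<le> D"
  shows "(\<integral>y. h y \<partial>transition P M (t + s) x)
    = (\<integral>y. (\<integral>z. h z \<partial>transition P M s y) \<partial>transition P M t x)"
  using markov_integral[OF st, of "\<lambda>_. 1" 1 h D x] h h_bnd
  by (simp add: integral_transition[OF add_in_T[OF st(2,1)] h]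
      integral_transition[OF st(2) transition_integral_measurable[OF st(1) h]])

end

section \<open>Invariance and uniqueness\<close>

text \<open>Transfers limits along \<open>at_top_in T\<close> to sequences of times. The natural
  numbers lie in \<open>T\<close> for both time sets, so sequential convergence theorems become
  available.\<close>

lemma filterlim_at_top_in:
  assumes "filterlim u at_top F" "\<And>x. u x \<in> T"
  shows "filterlim u (at_top_in T) F"
  using assms by (auto simp: at_top_in_def filterlim_inf filterlim_principal)

text \<open>Turns the setwise definition into an equation between measures, which can be tested on
  Lipschitz functions.\<close>

lemma invariant_measure_bind:
  assumes \<nu>: "\<nu> \<in> space (prob_algebra borel)"
    and p: "\<And>t. t \<in> T \<Longrightarrow> p t \<in> borel \<rightarrow>\<^sub>M prob_algebra borel"
  shows "invariant_measure T p \<nu> \<longleftrightarrow> (\<forall>t\<in>T. \<nu> \<bind> p t = \<nu>)"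
proof -
  note \<nu>' [measurable_cong] = prob_algebra_borelD(2)[OF \<nu>]
  have "(\<forall>B\<in>sets borel. (\<integral>\<^sup>+x. emeasure (p t x) B \<partial>\<nu>) = emeasure \<nu> B) \<longleftrightarrow> \<nu> \<bind> p t = \<nu>"
    if t: "t \<in> T" for t
  proof -
    have sets: "sets (\<nu> \<bind> p t) = sets borel"
      using measurable_space[OF p[OF t]] prob_algebra_borelD(3)[OF \<nu>]
      by (subst sets_bind[where N = borel]) (auto simp: space_prob_algebra)
    have "emeasure (\<nu> \<bind> p t) B = (\<integral>\<^sup>+x. emeasure (p t x) B \<partial>\<nu>)" if "B \<in> sets borel" for B
      using measurable_prob_algebraD[OF p[OF t]] prob_algebra_borelD(3)[OF \<nu>] that
      by (intro emeasure_bind[where N = borel]) auto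
    then show ?thesis
      using sets \<nu>' by (metis measure_eqI)
  qed
  then show ?thesis
    using \<nu>' by (auto simp: invariant_measure_def)
qed

locale contractive_markov_process = normal_markov_process T \<F> P \<F>\<^sub>t \<theta> M
  for T :: "real set"
    and \<F> :: "'w measure"
    and P :: "'s::polish_space \<Rightarrow> 'w measure"
    and \<F>\<^sub>t :: "real \<Rightarrow> 'w measure"
    and \<theta> :: "real \<Rightarrow> 'w \<Rightarrow> 'w"
    and M :: "real \<Rightarrow> 'w \<Rightarrow> 's" +
  fixes \<pi> :: "'s measure"
  assumes dist_le_1: "\<And>x y :: 's. dist x y \<le> 1"
    and \<pi>: "\<pi> \<in> space (prob_algebra borel)"
    and attraction: "\<And>x. ((\<lambda>t. dW (transition P M t x) \<pi>) \<longlongrightarrow> 0) (at_top_in T)"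
    and contraction: "\<And>t x\<^sub>1 x\<^sub>2. t \<in> T \<Longrightarrow>
      dW (transition P M t x\<^sub>1) (transition P M t x\<^sub>2) \<le> dist x\<^sub>1 x\<^sub>2"
begin

section \<open>The transition semigroup on Lipschitz functions, invariance and uniqueness\<close>

abbreviation D :: "real \<Rightarrow> 's \<Rightarrow> real" where
  "D t x \<equiv> dW (transition P M t x) \<pi>"

definition Q :: "real \<Rightarrow> ('s \<Rightarrow> real) \<Rightarrow> 's \<Rightarrow> real" where
  "Q t f x = (\<integral>y. f y \<partial>transition P M t x)"

text \<open>The dual form of the contraction hypothesis. The constant \<open>L\<close> does not
  depend on \<open>t\<close>, which makes later estimates uniform in the time lag.\<close>

lemma Q_lipschitz:
  assumes t: "t \<in> T" and f: "L-lipschitz_on UNIV f"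
  shows "L-lipschitz_on UNIV (Q t f)"
proof (rule lipschitz_onI)
  fix x y
  have "dist (Q t f x) (Q t f y) \<le> L * dW (transition P M t x) (transition P M t y)"
    unfolding Q_def dist_real_def
    by (rule dW_upper[OF dist_le_1 f transition_in_prob_algebra[OF t] transition_in_prob_algebra[OF t]])
  also have "\<dots> \<le> L * dist x y"
    using contraction[OF t] lipschitz_on_nonneg[OF f] by (intro mult_left_mono)
  finally show "dist (Q t f x) (Q t f y) \<le> L * dist x y" .
qed (rule lipschitz_on_nonneg[OF f])

lemma Q_deviation:
  assumes "t \<in> T" "L-lipschitz_on UNIV f"
  shows "\<bar>Q t f x - (\<integral>y. f y \<partial>\<pi>)\<bar> \<le> L * D t x"
  unfolding Q_def by (rule dW_upper[OF dist_le_1 assms(2) transition_in_prob_algebra[OF assms(1)] \<pi>])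

lemma Q_add:
  assumes "s \<in> T" "t \<in> T" "L-lipschitz_on UNIV f"
  shows "Q (t + s) f x = Q t (Q s f) x"
proof -
  obtain B where "\<And>x. \<bar>f x\<bar> \<le> B" using lipschitz_bounded[OF dist_le_1 assms(3)] by blast
  then show ?thesis
    unfolding Q_def by (rule chapman_kolmogorov[OF assms(1,2) lipschitz_borel_measurable[OF assms(3)]])
qed

lemma Q_tendsto:
  assumes f: "L-lipschitz_on UNIV f" and u: "filterlim u at_top F" "\<And>n. u n \<in> T"
  shows "((\<lambda>n. Q (u n) f x) \<longlongrightarrow> (\<integral>y. f y \<partial>\<pi>)) F"
proof -
  have "((\<lambda>n. D (u n) x) \<longlongrightarrow> 0) F"
    by (rule filterlim_compose[OF attraction filterlim_at_top_in[OF u]])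
  from tendsto_mult_left[OF this, of L]
  have "((\<lambda>n. L * D (u n) x) \<longlongrightarrow> 0) F" by simp
  then have "((\<lambda>n. Q (u n) f x - (\<integral>y. f y \<partial>\<pi>)) \<longlongrightarrow> 0) F"
    by (rule Lim_null_comparison[rotated]) (use Q_deviation[OF u(2) f] in auto)
  then show ?thesis by (simp add: LIM_zero_iff)
qed

text \<open>Duality: the kernel acting on measures is moved onto the test function.\<close>

lemma integral_bind_transition:
  assumes t: "t \<in> T" and f: "L-lipschitz_on UNIV f" and \<mu>: "\<mu> \<in> space (prob_algebra borel)"
  shows "(\<integral>x. f x \<partial>(\<mu> \<bind> transition P M t)) = (\<integral>x. Q t f x \<partial>\<mu>)"
proof -
  note [measurable_cong] = prob_algebra_borelD(2)[OF \<mu>]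
  obtain B where B: "\<And>x. \<bar>f x\<bar> \<le> B" using lipschitz_bounded[OF dist_le_1 f] by blast
  show ?thesis
    unfolding Q_def
  proof (rule integral_bind[where K = borel and B' = 1])
    show "f \<in> borel_measurable borel" by (rule lipschitz_borel_measurable[OF f])
    show "transition P M t \<in> \<mu> \<rightarrow>\<^sub>M subprob_algebra borel"
      using measurable_prob_algebraD[OF transition_measurable[OF t]]
      by (simp cong: measurable_cong_sets)
    show "finite_measure \<mu>"
      using prob_space.finite_measure prob_algebra_borelD(1)[OF \<mu>] .
    show "AE x in \<mu>. emeasure (transition P M t x) (space (transition P M t x)) \<le> ennreal 1"
      using prob_algebra_borelD(1)[OF transition_in_prob_algebra[OF t]]
      by (simp add: prob_space.emeasure_space_1)
  qed (use B in auto)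
qed

lemma bind_transition_in_prob_algebra:
  assumes "t \<in> T" "\<mu> \<in> space (prob_algebra borel)"
  shows "\<mu> \<bind> transition P M t \<in> space (prob_algebra borel)"
  \<comment> \<open>The library fact concerns families of measures; it is used for the constant
    family \<open>\<mu>\<close>.\<close>
  using measurable_space[OF measurable_bind_prob_space[OF _ transition_measurable[OF assms(1)], of "\<lambda>_. \<mu>" "count_space UNIV"]] assms(2)
  by auto

text \<open>From any starting point, the sequence \<open>Q (n + t) f x = Q n (Q t f) x\<close> tends
  to the mean of \<open>f\<close> and also to the mean of \<open>Q t f\<close>. The second limit is
  available because \<open>Q t f\<close> is again Lipschitz.\<close>

lemma integral_Q_\<pi>:
  assumes t: "t \<in> T" and f: "L-lipschitz_on UNIV f"
  shows "(\<integral>x. Q t f x \<partial>\<pi>) = (\<integral>x. f x \<partial>\<pi>)"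
proof (rule LIMSEQ_unique)
  fix x
  have lim: "filterlim (\<lambda>n. real n + t) at_top sequentially"
    using filterlim_tendsto_add_at_top[OF tendsto_const filterlim_real_sequentially, of t]
    by (simp add: add.commute)
  show "(\<lambda>n. Q (real n + t) f x) \<longlonglongrightarrow> (\<integral>x. f x \<partial>\<pi>)"
    using Q_tendsto[OF f lim] add_in_T[OF of_nat_in_T t] by simp
  show "(\<lambda>n. Q (real n + t) f x) \<longlonglongrightarrow> (\<integral>x. Q t f x \<partial>\<pi>)"
    using Q_tendsto[OF Q_lipschitz[OF t f] filterlim_real_sequentially of_nat_in_T]
    by (simp add: Q_add[OF t of_nat_in_T f])
qed

lemma invariant_iff_bind:
  "\<nu> \<in> space (prob_algebra borel) \<Longrightarrow>
    invariant_measure T (transition P M) \<nu> \<longleftrightarrow> (\<forall>t\<in>T. \<nu> \<bind> transition P M t = \<nu>)"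
  by (rule invariant_measure_bind) (auto intro: transition_measurable)

text \<open>By duality the Lipschitz integrals of both sides agree, and these determine the
  measure.\<close>

lemma invariant_\<pi>: "invariant_measure T (transition P M) \<pi>"
  unfolding invariant_iff_bind[OF \<pi>]
  by (intro ballI Lipschitz_integrals_determine_measure bind_transition_in_prob_algebra \<pi>)
    (simp_all add: integral_bind_transition[OF _ _ \<pi>] integral_Q_\<pi>)

text \<open>Invariance makes the \<open>\<nu>\<close>-integral of \<open>Q n f\<close> independent
  of \<open>n\<close>, while dominated convergence drives it to the \<open>\<pi>\<close>-mean of
  \<open>f\<close>.\<close>

lemma invariant_measure_unique:
  assumes \<nu>: "\<nu> \<in> space (prob_algebra borel)" and inv: "invariant_measure T (transition P M) \<nu>"
  shows "\<nu> = \<pi>"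
proof (rule Lipschitz_integrals_determine_measure[OF \<nu> \<pi>])
  fix f :: "'s \<Rightarrow> real" and L assume f: "L-lipschitz_on UNIV f"
  interpret prob_space \<nu> using prob_algebra_borelD[OF \<nu>] by simp
  note [measurable_cong] = prob_algebra_borelD(2)[OF \<nu>]
  have inv': "\<nu> \<bind> transition P M (real n) = \<nu>" for n
    using inv of_nat_in_T unfolding invariant_iff_bind[OF \<nu>] by blast
  obtain B where B: "\<And>x. \<bar>f x\<bar> \<le> B" using lipschitz_bounded[OF dist_le_1 f] by blast
  have Q_meas [measurable]: "Q (real n) f \<in> borel_measurable borel" for n
    by (rule lipschitz_borel_measurable[OF Q_lipschitz[OF of_nat_in_T f]])
  have "(\<lambda>n. \<integral>x. Q (real n) f x \<partial>\<nu>) \<longlonglongrightarrow> (\<integral>x. (\<integral>y. f y \<partial>\<pi>) \<partial>\<nu>)"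
  proof (rule integral_dominated_convergence[where w = "\<lambda>_. B"])
    show "AE x in \<nu>. (\<lambda>n. Q (real n) f x) \<longlonglongrightarrow> (\<integral>y. f y \<partial>\<pi>)"
      using Q_tendsto[OF f filterlim_real_sequentially of_nat_in_T] by simp
    show "AE x in \<nu>. norm (Q (real n) f x) \<le> B" for n
      using transition_integral_bounded[OF of_nat_in_T B]
      by (simp add: Q_def)
  qed auto
  then have "(\<lambda>n::nat. \<integral>x. f x \<partial>\<nu>) \<longlonglongrightarrow> (\<integral>y. f y \<partial>\<pi>)"
    using integral_bind_transition[OF of_nat_in_T f \<nu>] by (simp add: inv' prob_space)
  then show "(\<integral>x. f x \<partial>\<nu>) = (\<integral>y. f y \<partial>\<pi>)" by (simp add: LIMSEQ_const_iff)
qed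

section \<open>Regularity and decay of the distance to equilibrium\<close>

lemma D_nonneg: "t \<in> T \<Longrightarrow> 0 \<le> D t x"
  and D_le_1: "t \<in> T \<Longrightarrow> D t x \<le> 1"
  using dW_nonneg[OF dist_le_1 transition_in_prob_algebra \<pi>]
    dW_le_1[OF dist_le_1 transition_in_prob_algebra \<pi>] by auto

text \<open>\<open>D t\<close> is a supremum of the 1-Lipschitz functions
  \<open>\<bar>Q t f x - (\<integral>z. f z \<partial>\<pi>)\<bar>\<close>. Since the family is
  uncountable, measurability of \<open>D t\<close> is drawn from this continuity.\<close>

lemma D_lipschitz:
  assumes t: "t \<in> T"
  shows "1-lipschitz_on UNIV (D t)"
proof (rule lipschitz_onI)
  have *: "D t x \<le> D t y + dist x y" for x y
  proof (rule dW_least)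
    fix f :: "'s \<Rightarrow> real" assume f: "1-lipschitz_on UNIV f"
    have "\<bar>Q t f x - Q t f y\<bar> \<le> dist x y"
      using lipschitz_onD[OF Q_lipschitz[OF t f]] by (simp add: dist_real_def)
    then show "\<bar>(\<integral>z. f z \<partial>transition P M t x) - (\<integral>z. f z \<partial>\<pi>)\<bar> \<le> D t y + dist x y"
      using Q_deviation[OF t f, of y] unfolding Q_def by linarith
  qed
  fix x y
  show "dist (D t x) (D t y) \<le> 1 * dist x y"
    using *[of x y] *[of y x] by (simp add: dist_real_def dist_commute)
qed simp

text \<open>Composing a 1-Lipschitz test function with the semigroup gives a 1-Lipschitz test function
  with the same \<open>\<pi>\<close>-mean.\<close>

lemma D_antimono:
  assumes "s \<in> T" "t \<in> T" "s \<le> t"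
  shows "D t x \<le> D s x"
proof (rule dW_least)
  fix f :: "'s \<Rightarrow> real" assume f: "1-lipschitz_on UNIV f"
  note r = diff_in_T[OF assms]
  have "\<bar>Q s (Q (t - s) f) x - (\<integral>y. Q (t - s) f y \<partial>\<pi>)\<bar> \<le> 1 * D s x"
    by (rule Q_deviation[OF assms(1) Q_lipschitz[OF r f]])
  then show "\<bar>(\<integral>z. f z \<partial>transition P M t x) - (\<integral>z. f z \<partial>\<pi>)\<bar> \<le> D s x"
    using Q_add[OF r assms(1) f, of x] by (simp add: integral_Q_\<pi>[OF r f] flip: Q_def)
qed

lemma D_integrable:
  "t \<in> T \<Longrightarrow> \<mu> \<in> space (prob_algebra borel) \<Longrightarrow> integrable \<mu> (D t)"
  by (rule lipschitz_integrable[OF dist_le_1 D_lipschitz])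

lemma D_integral_le_1:
  assumes "t \<in> T" "\<mu> \<in> space (prob_algebra borel)"
  shows "(\<integral>x. D t x \<partial>\<mu>) \<le> 1"
proof -
  interpret prob_space \<mu> using prob_algebra_borelD[OF assms(2)] by simp
  show ?thesis
    using D_integrable[OF assms] D_le_1[OF assms(1)] by (intro integral_le_const) auto
qed

text \<open>Dominated convergence along the integers supplies one good time \<open>n\<close>;
  monotonicity of \<open>D\<close> extends the bound to all later times in \<open>T\<close>.\<close>

lemma D_integral_eventually_small:
  assumes \<mu>: "\<mu> \<in> space (prob_algebra borel)" and \<epsilon>: "\<epsilon> > 0"
  shows "\<exists>R\<ge>0. \<forall>t\<in>T. R \<le> t \<longrightarrow> (\<integral>x. D t x \<partial>\<mu>) \<le> \<epsilon>"
proof -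
  interpret prob_space \<mu> using prob_algebra_borelD[OF \<mu>] by simp
  note [measurable_cong] = prob_algebra_borelD(2)[OF \<mu>]
  have [measurable]: "D (real n) \<in> borel_measurable borel" for n
    by (rule lipschitz_borel_measurable[OF D_lipschitz[OF of_nat_in_T]])
  have "(\<lambda>n. \<integral>x. D (real n) x \<partial>\<mu>) \<longlonglongrightarrow> (\<integral>x. 0 \<partial>\<mu>)"
  proof (rule integral_dominated_convergence[where w = "\<lambda>_. 1"])
    show "AE x in \<mu>. (\<lambda>n. D (real n) x) \<longlonglongrightarrow> 0"
      using filterlim_compose[OF attraction filterlim_at_top_in[OF filterlim_real_sequentially of_nat_in_T]]
      by simp
    show "AE x in \<mu>. norm (D (real n) x) \<le> 1" for n
      using D_nonneg[OF of_nat_in_T] D_le_1[OF of_nat_in_T] by simp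
  qed auto
  then have "(\<lambda>n. \<integral>x. D (real n) x \<partial>\<mu>) \<longlonglongrightarrow> 0" by simp
  then have "eventually (\<lambda>n. (\<integral>x. D (real n) x \<partial>\<mu>) < \<epsilon>) sequentially"
    using \<epsilon> by (rule order_tendstoD)
  then obtain n where n: "(\<integral>x. D (real n) x \<partial>\<mu>) < \<epsilon>"
    by (auto simp: eventually_sequentially)
  have "(\<integral>x. D t x \<partial>\<mu>) \<le> \<epsilon>" if "t \<in> T" "real n \<le> t" for t
  proof -
    have "(\<integral>x. D t x \<partial>\<mu>) \<le> (\<integral>x. D (real n) x \<partial>\<mu>)"
      using that D_integrable[OF _ \<mu>] of_nat_in_T D_antimono by (intro integral_mono) auto
    then show ?thesis using n by simp
  qed
  then show ?thesis by (intro exI[of _ "real n"]) auto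
qed

end

section \<open>Time windows and second moments\<close>

text \<open>A finite measure carrying the time interval of the average, so that Fubini applies and
  discrete and continuous time are treated together.\<close>

definition window :: "real set \<Rightarrow> real \<Rightarrow> real measure" where
  "window T t = restrict_space (time_measure T) {0..<t}"

lemma window_nat: "window \<nat> t = count_space (\<nat> \<inter> {0..<t})"
proof -
  \<comment> \<open>\<open>time_measure\<close> chooses its branch by testing
    \<open>T = {0..}\<close>, so the two time sets must be told apart; \<open>1 / 2\<close> does
    it.\<close>
  have "(\<nat> :: real set) \<noteq> {0..}"
  proof
    assume "(\<nat> :: real set) = {0..}"
    moreover have "1 / 2 \<in> {0::real..}" by simp
    ultimately have "1 / 2 \<in> (\<nat> :: real set)" by simp
    then obtain n where "1 / 2 = real n" by (rule Nats_cases)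
    then have "real (2 * n) = real 1" by simp
    then show False by (simp only: of_nat_eq_iff) presburger
  qed
  then show ?thesis
    by (simp add: window_def time_measure_def restrict_count_space Int_commute)
qed

lemma window_nonneg: "window {0..} t = restrict_space lborel {0..<t}"
  unfolding window_def time_measure_def
  by (simp add: restrict_restrict_space) (metis Int_absorb1 atLeastLessThan_subseteq_atLeastAtMost_iff atLeastLessThan_iff atLeast_iff subsetI)

lemma finite_Nats_less: "finite (\<nat> \<inter> {0..<t::real})"
proof (rule finite_subset)
  show "\<nat> \<inter> {0..<t} \<subseteq> real ` {..nat \<lceil>t\<rceil>}"
    by (auto elim!: Nats_cases intro!: imageI) linarith
qed simp

context
  fixes T :: "real set"
  assumes T: "T = \<nat> \<or> T = {0..}"
begin

lemma space_window: "space (window T t) = T \<inter> {0..<t}"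
  using T by (auto simp: window_nat window_nonneg space_restrict_space)

lemma ident_measurable_window: "(\<lambda>s. s) \<in> window T t \<rightarrow>\<^sub>M borel"
  using T
proof
  assume "T = {0..}"
  then show ?thesis
    using measurable_restrict_space1[OF measurable_ident_sets[OF sets_lborel], of "{0..<t}"]
    by (simp add: window_nonneg)
qed (simp add: window_nat)

lemma finite_measure_window: "finite_measure (window T t)"
  using T
proof
  assume "T = \<nat>"
  then show ?thesis by (simp add: window_nat finite_measure_count_space finite_Nats_less)
next
  assume "T = {0..}"
  then show ?thesis
    by (intro finite_measureI, cases "0 \<le> t")
      (auto simp: window_nonneg emeasure_restrict_space space_restrict_space)
qed

text \<open>The half-open interval matters: for \<open>t = n\<close> in discrete time it holds the
  points 0 to \<open>n - 1\<close>, so the mass is exactly \<open>t\<close> in both cases.\<close>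

lemma measure_window:
  assumes "t \<in> T"
  shows "measure (window T t) (space (window T t)) = t"
  using T
proof
  assume TN: "T = \<nat>"
  then obtain n where n: "t = real n" using assms by (auto elim: Nats_cases)
  have "\<nat> \<inter> {0..<t} = real ` {..<n}"
    by (auto simp: n elim!: Nats_cases)
  then show ?thesis
    by (simp add: TN window_nat measure_count_space card_image n)
next
  assume "T = {0..}"
  then show ?thesis
    using assms by (simp add: window_nonneg measure_restrict_space space_restrict_space)
qed

text \<open>The extra 1 is for discrete time, where an interval can contain one integer more than
  its length. The bound is uniform in \<open>t\<close>.\<close>

lemma integral_window_indicator_le:
  assumes ab: "a \<le> b"
  shows "(\<integral>s. indicator {a<..<b} s \<partial>window T t) \<le> b - a + 1"
proof -
  have "(\<integral>s. indicator {a<..<b} s \<partial>window T t) = measure (window T t) ({a<..<b} \<inter> space (window T t))"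
    by simp
  also have "\<dots> \<le> b - a + 1"
    using T
  proof
    assume TN: "T = \<nat>"
    define A where "A = {n::nat. a < real n \<and> real n < b \<and> real n < t}"
    have eq: "{a<..<b} \<inter> (\<nat> \<inter> {0..<t}) = real ` A"
      by (auto simp: A_def elim!: Nats_cases)
    have "real (card A) \<le> b - a + 1"
    proof (cases "A = {}")
      case True
      then show ?thesis using ab by simp
    next
      case False
      \<comment> \<open>All integers counted lie within \<open>b - a\<close> of the smallest
        one.\<close>
      define m where "m = (LEAST n. n \<in> A)"
      have m: "m \<in> A" "n \<in> A \<Longrightarrow> m \<le> n" for n
        using False unfolding m_def by (auto intro: LeastI Least_le)
      have "A \<subseteq> {m..m + nat \<lfloor>b - a\<rfloor>}"
      proof
        fix n assume n: "n \<in> A"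
        have "real n - real m \<le> b - a" using n m(1) by (auto simp: A_def)
        then have "int n - int m \<le> \<lfloor>b - a\<rfloor>" by (simp add: le_floor_iff)
        then show "n \<in> {m..m + nat \<lfloor>b - a\<rfloor>}" using m(2)[OF n] by auto
      qed
      then have "card A \<le> card {m..m + nat \<lfloor>b - a\<rfloor>}" by (intro card_mono) auto
      then have "real (card A) \<le> real (nat \<lfloor>b - a\<rfloor>) + 1" by simp
      also have "\<dots> \<le> b - a + 1" using ab by simp
      finally show ?thesis .
    qed
    then show ?thesis
      using finite_Nats_less[of t]
      by (simp add: TN window_nat eq measure_count_space card_image)
        (metis Int_lower2 eq card_image finite_Int inj_on_of_nat finite_subset measure_count_space)
  next
    assume TR: "T = {0..}"
    have "measure (window T t) ({a<..<b} \<inter> space (window T t)) = measure lborel ({a<..<b} \<inter> {0..<t})"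
      by (simp add: TR window_nonneg measure_restrict_space space_restrict_space)
    also have "\<dots> \<le> measure lborel {a..b}"
      by (intro measure_mono_fmeasurable fmeasurableI) (auto simp: emeasure_lborel_Icc_eq)
    finally show ?thesis using ab by simp
  qed
  finally show ?thesis .
qed

lemma time_average_window:
  "time_average T M f t \<omega> = 1 / t * (\<integral>s. f (M s \<omega>) \<partial>window T t)"
proof -
  have "{0..<t} \<inter> space (time_measure T) \<in> sets (time_measure T)"
    using T by (auto simp: time_measure_def sets_restrict_space space_restrict_space)
  then show ?thesis
    unfolding time_average_def window_def set_lebesgue_integral_def
    by (simp add: integral_restrict_space)
qed

end

text \<open>One factor of the square is kept as a function \<open>Z\<close> of
  \<open>\<omega>\<close> while Fubini is applied to the other; a second Fubini, for fixed
  \<open>s\<close>, expands \<open>Z\<close>. Only products of two measures occur.\<close>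

lemma second_moment_integral:
  fixes Y :: "'a \<Rightarrow> 'b \<Rightarrow> real"
  assumes N: "finite_measure N" and R: "finite_measure R"
    and Y [measurable]: "case_prod Y \<in> borel_measurable (N \<Otimes>\<^sub>M R)" and bnd: "\<And>s \<omega>. \<bar>Y s \<omega>\<bar> \<le> B"
  shows "(\<integral>\<omega>. (\<integral>s. Y s \<omega> \<partial>N)\<^sup>2 \<partial>R) = (\<integral>s. (\<integral>u. (\<integral>\<omega>. Y s \<omega> * Y u \<omega> \<partial>R) \<partial>N) \<partial>N)"
proof -
  interpret N: finite_measure N by fact
  interpret R: finite_measure R by fact
  interpret NR: pair_sigma_finite N R ..
  interpret NR: finite_measure "N \<Otimes>\<^sub>M R"
    by (rule finite_measure_pair_measure[OF R N])
  define Z where "Z \<omega> = (\<integral>u. Y u \<omega> \<partial>N)" for \<omega>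
  have B: "0 \<le> B" using order_trans[OF abs_ge_zero bnd] .
  have Y_swap [measurable]: "(\<lambda>(\<omega>, s). Y s \<omega>) \<in> borel_measurable (R \<Otimes>\<^sub>M N)"
    by measurable
  have Z_meas [measurable]: "Z \<in> borel_measurable R"
    unfolding Z_def by (rule N.borel_measurable_lebesgue_integral) (rule Y_swap)
  have Z_bnd: "\<bar>Z \<omega>\<bar> \<le> B * measure N (space N)" for \<omega>
  proof -
    have "\<bar>Z \<omega>\<bar> \<le> (\<integral>u. \<bar>Y u \<omega>\<bar> \<partial>N)" unfolding Z_def by (rule integral_abs_bound)
    also have "\<dots> \<le> (\<integral>u. B \<partial>N)" using bnd B by (intro integral_mono') auto
    finally show ?thesis by (simp add: mult.commute)
  qed
  have int1: "integrable (N \<Otimes>\<^sub>M R) (\<lambda>(s, \<omega>). Y s \<omega> * Z \<omega>)"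
    using bnd Z_bnd B
    by (intro NR.integrable_const_bound[of _ "B * (B * measure N (space N))"])
      (auto simp: abs_mult split_beta intro!: mult_mono)
  have int2: "integrable (N \<Otimes>\<^sub>M R) (\<lambda>(u, \<omega>). Y s \<omega> * Y u \<omega>)" if [measurable]: "s \<in> space N" for s
    using bnd B
    by (intro NR.integrable_const_bound[of _ "B * B"])
      (auto simp: abs_mult split_beta intro!: mult_mono)
  have "(\<integral>\<omega>. (Z \<omega>)\<^sup>2 \<partial>R) = (\<integral>\<omega>. (\<integral>s. Y s \<omega> * Z \<omega> \<partial>N) \<partial>R)"
    by (simp add: Z_def power2_eq_square)
  also have "\<dots> = (\<integral>s. (\<integral>\<omega>. Y s \<omega> * Z \<omega> \<partial>R) \<partial>N)"
    by (rule NR.Fubini_integral[OF int1])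
  also have "\<dots> = (\<integral>s. (\<integral>\<omega>. (\<integral>u. Y s \<omega> * Y u \<omega> \<partial>N) \<partial>R) \<partial>N)"
    by (simp add: Z_def)
  also have "\<dots> = (\<integral>s. (\<integral>u. (\<integral>\<omega>. Y s \<omega> * Y u \<omega> \<partial>R) \<partial>N) \<partial>N)"
    by (intro Bochner_Integration.integral_cong refl NR.Fubini_integral[OF int2])
  finally show ?thesis by (simp add: Z_def)
qed

text \<open>A variable bounded by \<open>B\<close> satisfies
  \<open>\<bar>Z\<bar> powr p \<le> B powr (p - 1) * \<bar>Z\<bar>\<close>, and its first absolute
  moment is at most the root of its second moment.\<close>

lemma tendsto_Lp_of_second_moment:
  fixes N :: "'w measure" and X :: "real \<Rightarrow> 'w \<Rightarrow> real" and p c B :: real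
  assumes N: "prob_space N" and p: "p \<ge> 1" and T: "T \<noteq> {}"
    and X: "\<And>t. t \<in> T \<Longrightarrow> X t \<in> borel_measurable N"
    and bnd: "\<And>t \<omega>. t \<in> T \<Longrightarrow> \<bar>X t \<omega> - c\<bar> \<le> B"
    and lim: "((\<lambda>t. \<integral>\<omega>. (X t \<omega> - c)\<^sup>2 \<partial>N) \<longlongrightarrow> 0) (at_top_in T)"
  shows "tendsto_Lp N p T X (\<lambda>_. c)"
proof -
  interpret prob_space N by fact
  have B: "0 \<le> B" using T bnd order_trans[OF abs_ge_zero bnd] by blast
  have powr_int: "integrable N (\<lambda>\<omega>. \<bar>Z \<omega>\<bar> powr p)"
    if "Z \<in> borel_measurable N" "\<And>\<omega>. \<bar>Z \<omega>\<bar> \<le> b" for Z :: "_ \<Rightarrow> real" and b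
    using that p by (intro integrable_const_bound[of _ "b powr p"]) (auto intro!: powr_mono2)
  have in_Lp_X: "in_Lp N p (X t)" if t: "t \<in> T" for t
  proof -
    have "\<bar>X t \<omega>\<bar> \<le> B + \<bar>c\<bar>" for \<omega> using bnd[OF t, of \<omega>] by linarith
    then show ?thesis using X[OF t] powr_int unfolding in_Lp_def by blast
  qed
  have bound: "(\<integral>\<omega>. \<bar>X t \<omega> - c\<bar> powr p \<partial>N) \<le> B powr (p - 1) * sqrt (\<integral>\<omega>. (X t \<omega> - c)\<^sup>2 \<partial>N)"
    if t: "t \<in> T" for t
  proof -
    note [measurable] = X[OF t]
    have int1: "integrable N (\<lambda>\<omega>. \<bar>X t \<omega> - c\<bar>)"
      using bnd[OF t] by (intro integrable_const_bound[of _ B]) auto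
    have int2: "integrable N (\<lambda>\<omega>. \<bar>X t \<omega> - c\<bar>\<^sup>2)"
      using power_mono[OF bnd[OF t], where n = 2] by (intro integrable_const_bound[of _ "B\<^sup>2"]) auto
    have "(\<integral>\<omega>. \<bar>X t \<omega> - c\<bar> powr p \<partial>N) \<le> (\<integral>\<omega>. B powr (p - 1) * \<bar>X t \<omega> - c\<bar> \<partial>N)"
    proof (rule integral_mono')
      fix \<omega>
      \<comment> \<open>This also holds at 0 when \<open>p = 1\<close>: there
        \<open>0 powr 0\<close> is 0 by convention, and both sides vanish.\<close>
      have "\<bar>X t \<omega> - c\<bar> powr p = \<bar>X t \<omega> - c\<bar> powr (p - 1) * \<bar>X t \<omega> - c\<bar>"
        using powr_add[of "\<bar>X t \<omega> - c\<bar>" "p - 1" 1] by simp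
      also have "\<dots> \<le> B powr (p - 1) * \<bar>X t \<omega> - c\<bar>"
        using bnd[OF t] p by (intro mult_right_mono powr_mono2) auto
      finally show "\<bar>X t \<omega> - c\<bar> powr p \<le> B powr (p - 1) * \<bar>X t \<omega> - c\<bar>" .
    qed (use int1 in auto)
    also have "\<dots> = B powr (p - 1) * (\<integral>\<omega>. \<bar>X t \<omega> - c\<bar> \<partial>N)" by simp
    also have "\<dots> \<le> B powr (p - 1) * sqrt (\<integral>\<omega>. (X t \<omega> - c)\<^sup>2 \<partial>N)"
    proof (rule mult_left_mono)
      \<comment> \<open>The Cauchy-Schwarz inequality in the form that a variance is
        nonnegative.\<close>
      have "(\<integral>\<omega>. \<bar>X t \<omega> - c\<bar> \<partial>N)\<^sup>2 \<le> (\<integral>\<omega>. (X t \<omega> - c)\<^sup>2 \<partial>N)"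
        using variance_positive[of "\<lambda>\<omega>. \<bar>X t \<omega> - c\<bar>"] variance_eq[OF int1 int2] by simp
      then show "(\<integral>\<omega>. \<bar>X t \<omega> - c\<bar> \<partial>N) \<le> sqrt (\<integral>\<omega>. (X t \<omega> - c)\<^sup>2 \<partial>N)"
        by (rule real_le_rsqrt)
    qed simp
    finally show ?thesis .
  qed
  have "((\<lambda>t. B powr (p - 1) * sqrt (\<integral>\<omega>. (X t \<omega> - c)\<^sup>2 \<partial>N)) \<longlongrightarrow> 0) (at_top_in T)"
    using tendsto_mult_left[OF tendsto_real_sqrt[OF lim]] by simp
  moreover have "eventually (\<lambda>t. t \<in> T) (at_top_in T)"
    by (simp add: at_top_in_def eventually_inf_principal)
  ultimately have "((\<lambda>t. \<integral>\<omega>. \<bar>X t \<omega> - c\<bar> powr p \<partial>N) \<longlongrightarrow> 0) (at_top_in T)"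
    by (intro Lim_null_comparison[where f = "\<lambda>t. \<integral>\<omega>. \<bar>X t \<omega> - c\<bar> powr p \<partial>N"])
      (auto elim!: eventually_mono simp: bound)
  then have "((\<lambda>t. Lp_norm N p (\<lambda>\<omega>. X t \<omega> - c)) \<longlongrightarrow> 0) (at_top_in T)"
    unfolding Lp_norm_def using p by (intro tendsto_zero_powrI[OF _ tendsto_const]) auto
  moreover have "in_Lp N p (\<lambda>_. c)" unfolding in_Lp_def by simp
  ultimately show ?thesis using in_Lp_X by (simp add: tendsto_Lp_def)
qed

section \<open>Convergence of time averages\<close>

text \<open>Needed for Fubini. Countably many times require only measurability of each
  \<open>M s\<close>; in continuous time progressive measurability at \<open>t\<close> is pulled
  back along the inclusions of the window and of the filtration.\<close>

lemma (in normal_markov_process) jointly_measurable_window: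
  assumes t: "t \<in> T"
  shows "(\<lambda>(s, \<omega>). M s \<omega>) \<in> window T t \<Otimes>\<^sub>M \<F> \<rightarrow>\<^sub>M borel"
  using time_set
proof
  assume TN: "T = \<nat>"
  have "countable (\<nat> \<inter> {0..<t})" by (rule countable_finite[OF finite_Nats_less])
  then show ?thesis
    unfolding TN window_nat
    by (rule measurable_pair_measure_countable1) (use M_measurable TN in auto)
next
  assume TR: "T = {0..}"
  then have t0: "0 \<le> t" using t by simp
  have "(\<lambda>s. s) \<in> window T t \<rightarrow>\<^sub>M restrict_space borel {0..t}"
    using ident_measurable_window[OF time_set] space_window[OF time_set]
    by (intro measurable_restrict_space2) auto
  moreover have "(\<lambda>\<omega>. \<omega>) \<in> \<F> \<rightarrow>\<^sub>M \<F>\<^sub>t t"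
    using measurable_from_subalg[OF filtration_sub[OF t] measurable_ident] by (simp add: id_def)
  ultimately have "(\<lambda>x. (fst x, snd x)) \<in> window T t \<Otimes>\<^sub>M \<F> \<rightarrow>\<^sub>M restrict_space borel {0..t} \<Otimes>\<^sub>M \<F>\<^sub>t t"
    by (intro measurable_Pair measurable_compose[OF measurable_fst] measurable_compose[OF measurable_snd])
  from measurable_compose[OF this progressive[OF TR t0]]
  show ?thesis by (simp add: split_beta)
qed

section \<open>Decay of correlations and the second moment of the time average\<close>

context contractive_markov_process
begin

text \<open>Conditioning at the earlier time replaces the later factor by its semigroup image at lag
  \<open>u - s\<close>. The first factor is at most \<open>L\<close>, and the absolute value of that
  image is a Lipschitz function whose mean under \<open>P x\<close> is compared with its
  \<open>\<pi>\<close>-mean.\<close>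

lemma centered_correlation_P:
  assumes s: "s \<in> T" and u: "u \<in> T" and su: "s \<le> u" and f: "L-lipschitz_on UNIV f"
    and c: "c = (\<integral>y. f y \<partial>\<pi>)"
  shows "\<bar>\<integral>\<omega>. (f (M s \<omega>) - c) * (f (M u \<omega>) - c) \<partial>P x\<bar>
    \<le> L\<^sup>2 * ((\<integral>y. D (u - s) y \<partial>\<pi>) + D s x)"
proof -
  interpret prob_space "P x" by (rule prob_space_P)
  interpret \<pi>: prob_space \<pi> using prob_algebra_borelD[OF \<pi>] by simp
  define r where "r = u - s"
  have r: "r \<in> T" unfolding r_def using s u su by (rule diff_in_T)
  have u_eq: "u = s + r" by (simp add: r_def)
  have L: "0 \<le> L" using f by (rule lipschitz_on_nonneg)
  define g where "g y = f y - c" for y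
  have g: "L-lipschitz_on UNIV g"
    using f by (auto simp: g_def lipschitz_on_def dist_real_def)
  have g_meas: "g \<in> borel_measurable borel" by (rule lipschitz_borel_measurable[OF g])
  have g_bnd: "\<bar>g y\<bar> \<le> L" for y
    using lipschitz_integral_deviation[OF dist_le_1 f \<pi>] by (simp add: g_def c)
  have g_mean: "(\<integral>y. g y \<partial>\<pi>) = 0"
    using lipschitz_integrable[OF dist_le_1 f \<pi>] by (simp add: g_def c \<pi>.prob_space)
  \<comment> \<open>\<open>h\<close> is \<open>L\<close>-Lipschitz for every lag \<open>r\<close>, so \<open>Q s h x\<close> approaches \<open>\<integral>h d\<pi>\<close> uniformly in \<open>r\<close>.\<close>
  define h where "h y = \<bar>Q r g y\<bar>" for y
  have h: "L-lipschitz_on UNIV h"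
  proof (rule lipschitz_onI[OF _ L])
    fix y z
    show "dist (h y) (h z) \<le> L * dist y z"
      using lipschitz_onD[OF Q_lipschitz[OF r g], of y z] by (simp add: h_def dist_real_def)
  qed
  have h_meas: "h \<in> borel_measurable borel" by (rule lipschitz_borel_measurable[OF h])
  have h_bnd: "\<bar>h y\<bar> \<le> L" for y
    using transition_integral_bounded[OF r g_bnd] by (simp add: h_def Q_def)
  have "\<bar>\<integral>\<omega>. g (M s \<omega>) * g (M u \<omega>) \<partial>P x\<bar> = \<bar>\<integral>\<omega>. g (M s \<omega>) * Q r g (M s \<omega>) \<partial>P x\<bar>"
    unfolding u_eq Q_def using markov_integral[OF r s g_meas g_bnd g_meas g_bnd] by simp
  also have "\<dots> \<le> (\<integral>\<omega>. \<bar>g (M s \<omega>) * Q r g (M s \<omega>)\<bar> \<partial>P x)" by (rule integral_abs_bound)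
  also have "\<dots> \<le> (\<integral>\<omega>. L * h (M s \<omega>) \<partial>P x)"
  proof (rule integral_mono')
    show "integrable (P x) (\<lambda>\<omega>. L * h (M s \<omega>))"
      using h_bnd measurable_compose[OF M_measurable_P[OF s] h_meas]
      by (intro integrable_mult_right integrable_const_bound[of _ L]) auto
    show "\<bar>g (M s \<omega>) * Q r g (M s \<omega>)\<bar> \<le> L * h (M s \<omega>)" for \<omega>
      unfolding abs_mult h_def using g_bnd by (intro mult_right_mono) auto
  qed (use L in \<open>auto simp: h_def\<close>)
  also have "\<dots> = L * Q s h x"
    by (simp add: Q_def integral_transition[OF s h_meas])
  also have "\<dots> \<le> L * ((\<integral>y. h y \<partial>\<pi>) + L * D s x)"
    using Q_deviation[OF s h, of x] L by (intro mult_left_mono) auto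
  also have "\<dots> \<le> L * (L * (\<integral>y. D r y \<partial>\<pi>) + L * D s x)"
  proof -
    \<comment> \<open>As \<open>g\<close> has \<open>\<pi>\<close>-mean 0, \<open>Q r g\<close> is
      itself a deviation from equilibrium.\<close>
    have "h y \<le> L * D r y" for y
      using Q_deviation[OF r g, of y] by (simp add: h_def g_mean)
    then have "(\<integral>y. h y \<partial>\<pi>) \<le> (\<integral>y. L * D r y \<partial>\<pi>)"
      using lipschitz_integrable[OF dist_le_1 h \<pi>] D_integrable[OF r \<pi>]
      by (intro integral_mono) auto
    then show ?thesis using L by (intro mult_left_mono) auto
  qed
  also have "\<dots> = L\<^sup>2 * ((\<integral>y. D r y \<partial>\<pi>) + D s x)"
    by (simp add: power2_eq_square algebra_simps)
  finally show ?thesis by (simp add: g_def r_def)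
qed

lemma bind_P_in_prob_algebra:
  "\<mu> \<in> space (prob_algebra borel) \<Longrightarrow> \<mu> \<bind> P \<in> space (prob_algebra \<F>)"
  using measurable_space[OF measurable_bind_prob_space[OF _ kernel, of "\<lambda>_. \<mu>" "count_space UNIV"]]
  by auto

text \<open>The bound for a fixed starting point is integrated over \<open>\<mu>\<close>; its
  \<open>\<pi>\<close>-term does not depend on the starting point.\<close>

lemma centered_correlation:
  assumes s: "s \<in> T" and u: "u \<in> T" and su: "s \<le> u" and f: "L-lipschitz_on UNIV f"
    and c: "c = (\<integral>y. f y \<partial>\<pi>)" and \<mu>: "\<mu> \<in> space (prob_algebra borel)"
  shows "\<bar>\<integral>\<omega>. (f (M s \<omega>) - c) * (f (M u \<omega>) - c) \<partial>(\<mu> \<bind> P)\<bar>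
    \<le> L\<^sup>2 * ((\<integral>y. D (u - s) y \<partial>\<pi>) + (\<integral>x. D s x \<partial>\<mu>))"
proof -
  interpret prob_space \<mu> using prob_algebra_borelD[OF \<mu>] by simp
  note [measurable_cong] = prob_algebra_borelD(2)[OF \<mu>]
  note [measurable] = M_measurable[OF s] M_measurable[OF u] lipschitz_borel_measurable[OF f]
  have L: "0 \<le> L" using f by (rule lipschitz_on_nonneg)
  have g_bnd: "\<bar>f y - c\<bar> \<le> L" for y
    using lipschitz_integral_deviation[OF dist_le_1 f \<pi>] by (simp add: c)
  have r: "u - s \<in> T" using s u su by (rule diff_in_T)
  define k where "k \<omega> = (f (M s \<omega>) - c) * (f (M u \<omega>) - c)" for \<omega>
  have "(\<integral>\<omega>. k \<omega> \<partial>(\<mu> \<bind> P)) = (\<integral>x. (\<integral>\<omega>. k \<omega> \<partial>P x) \<partial>\<mu>)"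
  proof (rule integral_bind[where K = \<F> and B = "L * L" and B' = 1])
    show "k \<in> borel_measurable \<F>" unfolding k_def by measurable
    show "P \<in> \<mu> \<rightarrow>\<^sub>M subprob_algebra \<F>"
      using measurable_prob_algebraD[OF kernel] by (simp cong: measurable_cong_sets)
    show "finite_measure \<mu>" by unfold_locales
    show "\<bar>k \<omega>\<bar> \<le> L * L" for \<omega>
      unfolding k_def abs_mult using g_bnd L by (intro mult_mono) auto
    show "AE x in \<mu>. emeasure (P x) (space (P x)) \<le> ennreal 1"
      using prob_space.emeasure_space_1[OF prob_space_P] by simp
  qed
  also have "\<bar>\<dots>\<bar> \<le> (\<integral>x. \<bar>\<integral>\<omega>. k \<omega> \<partial>P x\<bar> \<partial>\<mu>)" by (rule integral_abs_bound)
  also have "\<dots> \<le> (\<integral>x. L\<^sup>2 * ((\<integral>y. D (u - s) y \<partial>\<pi>) + D s x) \<partial>\<mu>)"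
    unfolding k_def
    using centered_correlation_P[OF s u su f c] D_integrable[OF s \<mu>]
    by (intro integral_mono' integrable_mult_right Bochner_Integration.integrable_add)
      (auto simp: L D_nonneg[OF s] D_nonneg[OF r] intro!: mult_nonneg_nonneg add_nonneg_nonneg)
  also have "\<dots> = L\<^sup>2 * ((\<integral>y. D (u - s) y \<partial>\<pi>) + (\<integral>x. D s x \<partial>\<mu>))"
    using D_integrable[OF s \<mu>] by (simp add: prob_space)
  finally show ?thesis by (simp add: k_def)
qed

text \<open>Past the threshold \<open>R\<close> the integrals of \<open>D\<close> are at most
  \<open>\<epsilon>\<close>; before it they are at most 1, a cost charged to strips near
  \<open>s = 0\<close>, \<open>u = 0\<close> and \<open>s = u\<close>. This form no longer needs
  \<open>s \<le> u\<close>, so it can be integrated over the whole square.\<close>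

lemma centered_correlation_cutoff:
  assumes f: "L-lipschitz_on UNIV f" and c: "c = (\<integral>y. f y \<partial>\<pi>)"
    and \<mu>: "\<mu> \<in> space (prob_algebra borel)" and \<epsilon>: "0 \<le> \<epsilon>"
    and R\<pi>: "\<And>t. t \<in> T \<Longrightarrow> R \<le> t \<Longrightarrow> (\<integral>x. D t x \<partial>\<pi>) \<le> \<epsilon>"
    and R\<mu>: "\<And>t. t \<in> T \<Longrightarrow> R \<le> t \<Longrightarrow> (\<integral>x. D t x \<partial>\<mu>) \<le> \<epsilon>"
    and s: "s \<in> T" and u: "u \<in> T"
  shows "(\<integral>\<omega>. (f (M s \<omega>) - c) * (f (M u \<omega>) - c) \<partial>(\<mu> \<bind> P))
    \<le> L\<^sup>2 * (2 * \<epsilon> + indicator {-R<..<R} s + indicator {-R<..<R} u + indicator {s-R<..<s+R} u)"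
proof -
  have *: "(\<integral>\<omega>. (f (M s \<omega>) - c) * (f (M u \<omega>) - c) \<partial>(\<mu> \<bind> P))
      \<le> L\<^sup>2 * (2 * \<epsilon> + indicator {-R<..<R} s + indicator {s-R<..<s+R} u)"
    if s: "s \<in> T" and u: "u \<in> T" and su: "s \<le> u" for s u
  proof -
    have r: "u - s \<in> T" using s u su by (rule diff_in_T)
    have "(\<integral>x. D s x \<partial>\<mu>) \<le> \<epsilon> + indicator {-R<..<R} s"
      using R\<mu>[OF s] D_integral_le_1[OF s \<mu>] T_nonneg[OF s] \<epsilon>
      by (cases "R \<le> s") (auto simp: indicator_def)
    moreover have "(\<integral>x. D (u - s) x \<partial>\<pi>) \<le> \<epsilon> + indicator {s-R<..<s+R} u"
      using R\<pi>[OF r] D_integral_le_1[OF r \<pi>] su \<epsilon>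
      by (cases "R \<le> u - s") (auto simp: indicator_def)
    ultimately have "L\<^sup>2 * ((\<integral>y. D (u - s) y \<partial>\<pi>) + (\<integral>x. D s x \<partial>\<mu>))
        \<le> L\<^sup>2 * (2 * \<epsilon> + indicator {-R<..<R} s + indicator {s-R<..<s+R} u)"
      by (intro mult_left_mono) auto
    then show ?thesis
      using centered_correlation[OF s u su f c \<mu>] by linarith
  qed
  have mono: "L\<^sup>2 * a \<le> L\<^sup>2 * b" if "a \<le> b" for a b :: real
    using that by (rule mult_left_mono) simp
  show ?thesis
  proof (cases "s \<le> u")
    case True
    show ?thesis
      by (rule order_trans[OF *[OF s u True] mono]) (auto simp: indicator_def)
  next
    case False
    \<comment> \<open>For \<open>u < s\<close> the roles are exchanged; the strip around the
      diagonal is symmetric, and the product commutes.\<close>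
    have "(\<integral>\<omega>. (f (M u \<omega>) - c) * (f (M s \<omega>) - c) \<partial>(\<mu> \<bind> P))
      \<le> L\<^sup>2 * (2 * \<epsilon> + indicator {-R<..<R} s + indicator {-R<..<R} u + indicator {s-R<..<s+R} u)"
      using False by (intro order_trans[OF *[OF u s] mono]) (auto simp: indicator_def)
    then show ?thesis by (simp add: mult.commute)
  qed
qed

text \<open>Each of the three strips has mass at most \<open>2 * R + 1\<close> in one variable and
  \<open>t\<close> in the other. Dividing by the square of \<open>t\<close> leaves
  \<open>3 * (2 * R + 1) / t\<close>.\<close>

lemma second_moment_time_average:
  assumes f: "L-lipschitz_on UNIV f" and c: "c = (\<integral>y. f y \<partial>\<pi>)"
    and \<mu>: "\<mu> \<in> space (prob_algebra borel)" and \<epsilon>: "0 \<le> \<epsilon>" and R: "0 \<le> R"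
    and R\<pi>: "\<And>t. t \<in> T \<Longrightarrow> R \<le> t \<Longrightarrow> (\<integral>x. D t x \<partial>\<pi>) \<le> \<epsilon>"
    and R\<mu>: "\<And>t. t \<in> T \<Longrightarrow> R \<le> t \<Longrightarrow> (\<integral>x. D t x \<partial>\<mu>) \<le> \<epsilon>"
    and t: "t \<in> T" and t0: "0 < t"
  shows "(\<integral>\<omega>. (time_average T M f t \<omega> - c)\<^sup>2 \<partial>(\<mu> \<bind> P)) \<le> L\<^sup>2 * (2 * \<epsilon> + 3 * (2 * R + 1) / t)"
proof -
  define N where "N = window T t"
  define W where "W = \<mu> \<bind> P"
  interpret N: finite_measure N unfolding N_def by (rule finite_measure_window[OF time_set])
  have W: "prob_space W" "sets W = sets \<F>"
    using bind_P_in_prob_algebra[OF \<mu>] by (auto simp: W_def space_prob_algebra)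
  interpret W: prob_space W by fact
  note [measurable_cong] = W(2)
  have L: "0 \<le> L" using f by (rule lipschitz_on_nonneg)
  define g where "g y = f y - c" for y
  have g_bnd: "\<bar>g y\<bar> \<le> L" for y
    using lipschitz_integral_deviation[OF dist_le_1 f \<pi>] by (simp add: g_def c)
  have [measurable]: "f \<in> borel_measurable borel" by (rule lipschitz_borel_measurable[OF f])
  have g_meas [measurable]: "g \<in> borel_measurable borel" unfolding g_def by measurable
  have joint: "(\<lambda>(s, \<omega>). M s \<omega>) \<in> N \<Otimes>\<^sub>M \<F> \<rightarrow>\<^sub>M borel"
    unfolding N_def by (rule jointly_measurable_window[OF t])
  have joint_g: "(\<lambda>(s, \<omega>). g (M s \<omega>)) \<in> borel_measurable (N \<Otimes>\<^sub>M W)"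
    using measurable_compose[OF joint g_meas] by (simp add: split_beta cong: measurable_cong_sets)
  have sN: "measure N (space N) = t"
    unfolding N_def by (rule measure_window[OF time_set t])
  have spN: "s \<in> T" if "s \<in> space N" for s
    using that space_window[OF time_set] by (auto simp: N_def)
  have ind_meas [measurable]: "{a<..<b} \<inter> space N \<in> sets N" for a b
    using measurable_sets[OF ident_measurable_window[OF time_set, of t], of "{a<..<b}"]
    by (simp add: N_def)
  have ind_int: "integrable N (indicator {a<..<b} :: real \<Rightarrow> real)" for a b
    using ind_meas N.emeasure_finite by (simp add: integrable_indicator_iff less_top[symmetric])
  have ind_le: "(\<integral>s. indicator {a<..<b} s \<partial>N) \<le> b - a + 1" if "a \<le> b" for a b
    unfolding N_def by (rule integral_window_indicator_le[OF time_set that])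
  have average: "time_average T M f t \<omega> - c = 1 / t * (\<integral>s. g (M s \<omega>) \<partial>N)" if \<omega>: "\<omega> \<in> space W" for \<omega>
  proof -
    have \<omega>': "\<omega> \<in> space \<F>" using \<omega> sets_eq_imp_space_eq[OF W(2)] by simp
    have "integrable N (\<lambda>s. g (M s \<omega>))"
      using g_bnd measurable_compose[OF measurable_Pair2'[OF \<omega>'] measurable_compose[OF joint g_meas]]
      by (intro N.integrable_const_bound[of _ L]) auto
    then have "(\<integral>s. g (M s \<omega>) + c \<partial>N) = (\<integral>s. g (M s \<omega>) \<partial>N) + t * c"
      by (simp add: sN)
    then show ?thesis
      using t0 unfolding time_average_window[OF time_set] N_def[symmetric]
      by (simp add: g_def field_simps)
  qed
  have "(\<integral>\<omega>. (time_average T M f t \<omega> - c)\<^sup>2 \<partial>W) = (\<integral>\<omega>. 1 / t\<^sup>2 * (\<integral>s. g (M s \<omega>) \<partial>N)\<^sup>2 \<partial>W)"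
    by (intro Bochner_Integration.integral_cong refl) (simp add: average power_divide)
  also have "\<dots> = 1 / t\<^sup>2 * (\<integral>\<omega>. (\<integral>s. g (M s \<omega>) \<partial>N)\<^sup>2 \<partial>W)" by simp
  also have "(\<integral>\<omega>. (\<integral>s. g (M s \<omega>) \<partial>N)\<^sup>2 \<partial>W)
      = (\<integral>s. (\<integral>u. (\<integral>\<omega>. g (M s \<omega>) * g (M u \<omega>) \<partial>W) \<partial>N) \<partial>N)"
    by (rule second_moment_integral[OF _ _ joint_g g_bnd]) unfold_locales
  \<comment> \<open>The inner integral over \<open>u\<close> handles two strips, each at most
    \<open>2 * R + 1\<close>; the strip in \<open>s\<close> only gains the factor \<open>t\<close>
    and is integrated last.\<close>
  also have "\<dots> \<le> (\<integral>s. L\<^sup>2 * (2 * \<epsilon> * t + t * indicator {-R<..<R} s + 2 * (2 * R + 1)) \<partial>N)"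
  proof (rule integral_mono')
    fix s assume s: "s \<in> space N"
    have "(\<integral>u. (\<integral>\<omega>. g (M s \<omega>) * g (M u \<omega>) \<partial>W) \<partial>N)
      \<le> (\<integral>u. L\<^sup>2 * (2 * \<epsilon> + indicator {-R<..<R} s + indicator {-R<..<R} u + indicator {s-R<..<s+R} u) \<partial>N)"
      unfolding g_def W_def
      using \<epsilon> spN s
      by (intro integral_mono' centered_correlation_cutoff[OF f c \<mu> \<epsilon> R\<pi> R\<mu>] integrable_mult_right
          Bochner_Integration.integrable_add ind_int N.integrable_const) auto
    also have "\<dots> = L\<^sup>2 * (2 * \<epsilon> * t + t * indicator {-R<..<R} s
        + (\<integral>u. indicator {-R<..<R} u \<partial>N) + (\<integral>u. indicator {s-R<..<s+R} u \<partial>N))"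
      by (simp add: ind_int sN distrib_left mult_ac del: Bochner_Integration.integral_indicator)
    also have "\<dots> \<le> L\<^sup>2 * (2 * \<epsilon> * t + t * indicator {-R<..<R} s + 2 * (2 * R + 1))"
      using ind_le[of "-R" R] ind_le[of "s - R" "s + R"] R by (intro mult_left_mono) auto
    finally show "(\<integral>u. (\<integral>\<omega>. g (M s \<omega>) * g (M u \<omega>) \<partial>W) \<partial>N)
      \<le> L\<^sup>2 * (2 * \<epsilon> * t + t * indicator {-R<..<R} s + 2 * (2 * R + 1))" .
  qed (use ind_int \<epsilon> t0 R in auto)
  also have "\<dots> = L\<^sup>2 * (2 * \<epsilon> * t * t + t * (\<integral>s. indicator {-R<..<R} s \<partial>N) + 2 * (2 * R + 1) * t)"
    by (simp add: ind_int sN distrib_left mult_ac del: Bochner_Integration.integral_indicator)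
  also have "\<dots> \<le> L\<^sup>2 * (2 * \<epsilon> * t * t + t * (2 * R + 1) + 2 * (2 * R + 1) * t)"
    using ind_le[of "-R" R] R t0 \<epsilon> by (intro mult_left_mono add_mono) auto
  finally have "(\<integral>\<omega>. (time_average T M f t \<omega> - c)\<^sup>2 \<partial>W)
      \<le> 1 / t\<^sup>2 * (L\<^sup>2 * (2 * \<epsilon> * t * t + t * (2 * R + 1) + 2 * (2 * R + 1) * t))"
    using t0 by (simp add: divide_right_mono)
  also have "\<dots> = L\<^sup>2 * (2 * \<epsilon> + 3 * (2 * R + 1) / t)"
    using t0 by (simp add: field_simps power2_eq_square)
  finally show ?thesis by (simp add: W_def)
qed

lemma time_average_tendsto_Lp:
  assumes p: "p \<ge> 1" and f: "f \<in> Lip" and \<mu>: "\<mu> \<in> space (prob_algebra borel)"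
  shows "tendsto_Lp (\<mu> \<bind> P) p T (time_average T M f) (\<lambda>_. \<integral>y. f y \<partial>\<pi>)"
proof -
  obtain L where f: "L-lipschitz_on UNIV f" using f by (auto simp: Lip_def)
  have L: "0 \<le> L" using f by (rule lipschitz_on_nonneg)
  define c where "c = (\<integral>y. f y \<partial>\<pi>)"
  define W where "W = \<mu> \<bind> P"
  have W: "prob_space W" "sets W = sets \<F>"
    using bind_P_in_prob_algebra[OF \<mu>] by (auto simp: W_def space_prob_algebra)
  have f_meas: "f \<in> borel_measurable borel" by (rule lipschitz_borel_measurable[OF f])
  obtain B where B: "\<And>x. \<bar>f x\<bar> \<le> B" using lipschitz_bounded[OF dist_le_1 f] by blast
  have "tendsto_Lp W p T (time_average T M f) (\<lambda>_. c)"
  proof (rule tendsto_Lp_of_second_moment[OF W(1) p])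
    show "T \<noteq> {}" using zero_in_T by blast
    fix t assume t: "t \<in> T"
    interpret N: finite_measure "window T t" by (rule finite_measure_window[OF time_set])
    have "(\<lambda>(\<omega>, s). f (M s \<omega>)) \<in> borel_measurable (\<F> \<Otimes>\<^sub>M window T t)"
      using measurable_compose[OF measurable_pair_swap'
          measurable_compose[OF jointly_measurable_window[OF t] f_meas]]
      by (simp add: split_beta)
    then have "(\<lambda>\<omega>. \<integral>s. f (M s \<omega>) \<partial>window T t) \<in> borel_measurable \<F>"
      by (rule N.borel_measurable_lebesgue_integral)
    then show "time_average T M f t \<in> borel_measurable W"
      unfolding time_average_window[OF time_set, abs_def]
      by (simp cong: measurable_cong_sets add: W(2))
    fix \<omega>
    have "\<bar>\<integral>s. f (M s \<omega>) \<partial>window T t\<bar> \<le> (\<integral>s. \<bar>f (M s \<omega>)\<bar> \<partial>window T t)"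
      by (rule integral_abs_bound)
    also have "\<dots> \<le> (\<integral>s. B \<partial>window T t)"
      using B order_trans[OF abs_ge_zero B] by (intro integral_mono') auto
    also have "\<dots> = t * B" by (simp add: measure_window[OF time_set t])
    \<comment> \<open>At \<open>t = 0\<close> the average is 0 by the division convention, and the
      bound rests on \<open>0 \<le> B\<close>.\<close>
    finally have "\<bar>time_average T M f t \<omega>\<bar> \<le> B"
      using T_nonneg[OF t] order_trans[OF abs_ge_zero B]
      unfolding time_average_window[OF time_set]
      by (cases "t = 0") (auto simp: abs_mult field_simps)
    then show "\<bar>time_average T M f t \<omega> - c\<bar> \<le> B + \<bar>c\<bar>" by linarith
  next
    show "((\<lambda>t. \<integral>\<omega>. (time_average T M f t \<omega> - c)\<^sup>2 \<partial>W) \<longlongrightarrow> 0) (at_top_in T)"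
    proof (rule order_tendstoI)
      fix a :: real assume "a < 0"
      then show "\<forall>\<^sub>F t in at_top_in T. a < (\<integral>\<omega>. (time_average T M f t \<omega> - c)\<^sup>2 \<partial>W)"
        by (intro always_eventually allI) (auto intro: less_le_trans)
    next
      fix e :: real assume e: "0 < e"
      \<comment> \<open>Chosen so that the limit \<open>L\<^sup>2 * 2 * \<epsilon>\<close> of the
        bound is at most \<open>e / 2\<close>; the added 1 guards against
        \<open>L = 0\<close>.\<close>
      define \<epsilon> where "\<epsilon> = e / (4 * (L\<^sup>2 + 1))"
      have L1: "0 < L\<^sup>2 + 1" by (simp add: add_nonneg_pos)
      have \<epsilon>: "0 < \<epsilon>" using e L1 by (simp add: \<epsilon>_def)
      obtain R1 where R1: "0 \<le> R1" "\<And>t. t \<in> T \<Longrightarrow> R1 \<le> t \<Longrightarrow> (\<integral>x. D t x \<partial>\<pi>) \<le> \<epsilon>"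
        using D_integral_eventually_small[OF \<pi> \<epsilon>] by blast
      obtain R2 where R2: "0 \<le> R2" "\<And>t. t \<in> T \<Longrightarrow> R2 \<le> t \<Longrightarrow> (\<integral>x. D t x \<partial>\<mu>) \<le> \<epsilon>"
        using D_integral_eventually_small[OF \<mu> \<epsilon>] by blast
      define R where "R = max R1 R2"
      define K where "K = 3 * (2 * R + 1)"
      have bound: "(\<integral>\<omega>. (time_average T M f t \<omega> - c)\<^sup>2 \<partial>W) \<le> L\<^sup>2 * (2 * \<epsilon> + K / t)"
        if "t \<in> T" "0 < t" for t
        unfolding W_def K_def
        using \<epsilon> R1 R2 that
        by (intro second_moment_time_average[OF f c_def \<mu>]) (auto simp: R_def)
      have "((\<lambda>t. L\<^sup>2 * (2 * \<epsilon> + K / t)) \<longlongrightarrow> L\<^sup>2 * (2 * \<epsilon> + 0)) at_top"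
        by (intro tendsto_intros tendsto_divide_0[OF tendsto_const] filterlim_at_top_imp_at_infinity filterlim_ident)
      moreover have "L\<^sup>2 * (2 * \<epsilon> + 0) < e"
      proof -
        have "L\<^sup>2 * (2 * \<epsilon>) \<le> (L\<^sup>2 + 1) * (2 * \<epsilon>)" using \<epsilon> by (intro mult_right_mono) auto
        also have "\<dots> = e / 2" using L1 by (simp add: \<epsilon>_def field_simps)
        finally show ?thesis using e by simp
      qed
      ultimately have "\<forall>\<^sub>F t in at_top. L\<^sup>2 * (2 * \<epsilon> + K / t) < e" by (rule order_tendstoD)
      then have "\<forall>\<^sub>F t in at_top. t \<in> T \<longrightarrow> (\<integral>\<omega>. (time_average T M f t \<omega> - c)\<^sup>2 \<partial>W) < e"
        using eventually_gt_at_top[of 0] by eventually_elim (use bound in force)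
      then show "\<forall>\<^sub>F t in at_top_in T. (\<integral>\<omega>. (time_average T M f t \<omega> - c)\<^sup>2 \<partial>W) < e"
        by (simp add: at_top_in_def eventually_inf_principal)
    qed
  qed
  then show ?thesis by (simp add: W_def c_def)
qed

end

theorem theorem1p7:
  fixes T :: "real set"
    and \<F> :: "'w measure"
    and P :: "'s::polish_space \<Rightarrow> 'w measure"
    and \<F>\<^sub>t :: "real \<Rightarrow> 'w measure"
    and \<theta> :: "real \<Rightarrow> 'w \<Rightarrow> 'w"
    and M :: "real \<Rightarrow> 'w \<Rightarrow> 's"
    and \<pi> :: "'s measure"
  assumes "\<And>x y :: 's. dist x y \<le> 1"
    and "normal_markov_process T \<F> P \<F>\<^sub>t \<theta> M"
    and "\<pi> \<in> space (prob_algebra borel)"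
    and "\<And>x. ((\<lambda>t. dW (transition P M t x) \<pi>) \<longlongrightarrow> 0) (at_top_in T)"
    and "\<And>t x\<^sub>1 x\<^sub>2. t \<in> T \<Longrightarrow>
      dW (transition P M t x\<^sub>1) (transition P M t x\<^sub>2) \<le> dist x\<^sub>1 x\<^sub>2"
  shows "invariant_measure T (transition P M) \<pi> \<and>
    (\<forall>\<nu> \<in> space (prob_algebra borel). invariant_measure T (transition P M) \<nu> \<longrightarrow> \<nu> = \<pi>) \<and>
    (\<forall>p \<ge> (1::real). \<forall>f \<in> Lip. \<forall>\<mu> \<in> space (prob_algebra borel).
      tendsto_Lp (\<mu> \<bind> P) p T (time_average T M f) (\<lambda>_. \<integral>y. f y \<partial>\<pi>))"
proof -
  interpret normal_markov_process T \<F> P \<F>\<^sub>t \<theta> M by fact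
  interpret contractive_markov_process T \<F> P \<F>\<^sub>t \<theta> M \<pi>
    by unfold_locales (fact assms)+
  show ?thesis
    using invariant_\<pi> invariant_measure_unique time_average_tendsto_Lp by blast
qed

end
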